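(* There exist a finite group $A\cong C_{21}$ (cyclic of order $21$) and a finite $2$-group $G$ of order $2^{135}$, with $A$ acting faithfully and coprimely on $G$ by automorphisms, such that $$|N_A(G)|=1728\qquad\text{and}\qquad |C_G(A)/C_G(A)'|=4096 .$$ In particular, the equality $|N_A(G)|=|C_G(A)/C_G(A)'|$ fails for this coprime action.
   Context: Groups are finite and characters are complex. A group $A$ acts coprimely on $G$ if it acts by automorphisms and $\gcd(|A|,|G|)=1$. $C=C_G(A)$ is the subgroup of elements of $G$ fixed by every $a\in A$, and $C'$ is its derived subgroup. $\operatorname{Irr}_A(G)$ is the set of $A$-invariant irreducible characters of $G$, and $N_A(G)=\{\chi\in\operatorname{Irr}_A(G):\chi(c)\neq 0\text{ for all }c\in C\}$. *)

theory Defs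
  imports
    "HOL-Algebra.Group_Action"
    "HOL-Algebra.Generated_Groups"
    "HOL-Algebra.Elementary_Groups"
    "Jordan_Normal_Form.VS_Connect"
begin

section \<open>Irreducible complex characters of a group\<close>

abbreviation GL :: "nat \<Rightarrow> complex mat monoid" where
  "GL n \<equiv> units_of (ring_mat TYPE(complex) n ())"

definition mat_trace :: "'a :: comm_monoid_add mat \<Rightarrow> 'a" where
  "mat_trace M = (\<Sum>i<dim_row M. M $$ (i, i))"

definition representation ::
  "('g, 'm) monoid_scheme \<Rightarrow> nat \<Rightarrow> ('g \<Rightarrow> complex mat) \<Rightarrow> bool" where
  "representation G n \<rho> \<longleftrightarrow> \<rho> \<in> hom G (GL n)"

definition invariant_subspace ::
  "('g, 'm) monoid_scheme \<Rightarrow> nat \<Rightarrow> ('g \<Rightarrow> complex mat) \<Rightarrow> complex vec set \<Rightarrow> bool" where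
  "invariant_subspace G n \<rho> W \<longleftrightarrow>
     VectorSpace.subspace class_ring W (module_vec TYPE(complex) n) \<and>
     (\<forall>g\<in>carrier G. \<forall>w\<in>W. \<rho> g *\<^sub>v w \<in> W)"

definition irreducible_representation ::
  "('g, 'm) monoid_scheme \<Rightarrow> nat \<Rightarrow> ('g \<Rightarrow> complex mat) \<Rightarrow> bool" where
  "irreducible_representation G n \<rho> \<longleftrightarrow>
     representation G n \<rho> \<and> 0 < n \<and>
     (\<forall>W. invariant_subspace G n \<rho> W \<longrightarrow> W = {0\<^sub>v n} \<or> W = carrier_vec n)"

text \<open>Characters are restricted to the carrier, so that characters agreeing on the group
  are equal as HOL functions and sets of characters have the right cardinality.\<close>

definition character_of ::
  "('g, 'm) monoid_scheme \<Rightarrow> ('g \<Rightarrow> complex mat) \<Rightarrow> 'g \<Rightarrow> complex" where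
  "character_of G \<rho> = (\<lambda>g\<in>carrier G. mat_trace (\<rho> g))"

definition Irr :: "('g, 'm) monoid_scheme \<Rightarrow> ('g \<Rightarrow> complex) set" where
  "Irr G = {character_of G \<rho> | n \<rho>. irreducible_representation G n \<rho>}"

section \<open>Coprime actions\<close>

locale coprime_action = A: group A + G: group G
  for A :: "('a, 'm) monoid_scheme" and G :: "('g, 'n) monoid_scheme"
    and \<phi> :: "'a \<Rightarrow> 'g \<Rightarrow> 'g" +
  assumes finite_A: "finite (carrier A)"
    and finite_G: "finite (carrier G)"
    and action_hom: "\<phi> \<in> hom A (AutoGroup G)"
    and coprime_orders: "coprime (Coset.order A) (Coset.order G)"

text \<open>The group \<open>C\<^sub>G(A)\<close>, with the group structure inherited from \<open>G\<close>.\<close>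

definition fixed_group ::
  "('a, 'm) monoid_scheme \<Rightarrow> 'g monoid \<Rightarrow> ('a \<Rightarrow> 'g \<Rightarrow> 'g) \<Rightarrow> 'g monoid" where
  "fixed_group A G \<phi> = G\<lparr>carrier := {g \<in> carrier G. \<forall>a\<in>carrier A. \<phi> a g = g}\<rparr>"

definition abelianization :: "'g monoid \<Rightarrow> 'g set monoid" where
  "abelianization H = H Mod derived H (carrier H)"

definition Irr_inv ::
  "('a, 'm) monoid_scheme \<Rightarrow> 'g monoid \<Rightarrow> ('a \<Rightarrow> 'g \<Rightarrow> 'g) \<Rightarrow> ('g \<Rightarrow> complex) set" where
  "Irr_inv A G \<phi> = {\<chi> \<in> Irr G. \<forall>a\<in>carrier A. \<forall>g\<in>carrier G. \<chi> (\<phi> a g) = \<chi> g}"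

text \<open>\<open>N\<^sub>A(G)\<close>\<close>

definition Irr_inv_nonvanishing ::
  "('a, 'm) monoid_scheme \<Rightarrow> 'g monoid \<Rightarrow> ('a \<Rightarrow> 'g \<Rightarrow> 'g) \<Rightarrow> ('g \<Rightarrow> complex) set" where
  "Irr_inv_nonvanishing A G \<phi> =
     {\<chi> \<in> Irr_inv A G \<phi>. \<forall>c\<in>carrier (fixed_group A G \<phi>). \<chi> c \<noteq> 0}"

end

theory Submission
  imports Defs "HOL-Library.Z2" "HOL-Library.Function_Algebras" "HOL-Library.Product_Plus"
    "HOL-Library.Countable" "HOL-Library.Cardinality"
begin

text \<open>
  Let \<open>V\<close> be an elementary abelian 2-group with an automorphism \<open>\<alpha>\<close> of odd order that fixes only 0, and let
  \<open>A\<close> be the group generated by \<open>\<alpha>\<close>. It acts on \<open>G = C\<^sub>2 wr V\<close>, the semidirect product of the group of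
  binary functions on \<open>V\<close> (the base group) with \<open>V\<close> acting by translation. Since \<open>\<alpha>\<close> has no fixed points
  on \<open>V\<close>, the group \<open>C\<close> of fixed points consists of the \<open>\<alpha>\<close>-invariant functions in the base group. It is
  abelian, so \<open>|C / C'|\<close> is the number of invariant functions.

  The characters of the base group are again given by binary functions on \<open>V\<close>, called weights here. The
  weights of an irreducible representation of \<open>G\<close> form an orbit of \<open>V\<close>. If its character is
  \<open>A\<close>-invariant, then so is the orbit, and because \<open>\<alpha> - 1\<close> is bijective on \<open>V\<close> and on all stabilisers
  of invariant functions, the orbit contains exactly one invariant function \<open>S\<close>, whose stabiliser in
  \<open>V\<close> acts trivially on its weight space. Hence the invariant irreducible characters correspond to the
  invariant functions \<open>S\<close> (\<open>invariant_irreducible_characters\<close>, \<open>inj_orbit_character\<close>). The one belonging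
  to \<open>S\<close> vanishes at the fixed point \<open>T\<close> iff the convolution product of \<open>S\<close> and \<open>T\<close> takes the values 0 and
  1 equally often (\<open>orbit_character_base_eq_0_iff\<close>). The question is thus which elements \<open>S\<close> of the
  ring of invariants of the group algebra of \<open>V\<close> over the field with two elements divide an element
  with as many zeros as ones.

  Now take \<open>V = F\<^sub>4\<^sup>2 \<times> F\<^sub>8\<close>, with \<open>\<alpha>\<close> acting as multiplication by a cube root of unity on \<open>F\<^sub>4\<^sup>2\<close> and by a seventh
  root of unity on \<open>F\<^sub>8\<close>. Then \<open>|G| = 2\<^bsup>128 + 7\<^esup>\<close>. The ring of invariants has the basis \<open>1, l\<^sub>i, s, l\<^sub>i s\<close>, where
  the \<open>l\<^sub>i\<close> are the sums over the five lines through the origin of \<open>F\<^sub>4\<^sup>2\<close> and \<open>s\<close> is the sum over \<open>F\<^sub>8\<close>, with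
  \<open>l\<^sub>i\<^sup>2 = s\<^sup>2 = 0\<close> and \<open>l\<^sub>i l\<^sub>j = \<Sum>\<^sub>k l\<^sub>k\<close> for \<open>i \<noteq> j\<close>. It has \<open>2\<^bsup>12\<^esup> = 4096\<close> elements. Comparing orbit sizes shows that
  there are 20 elements with equally many zeros and ones (\<open>sum_bsign_invariant_fun_eq_0_iff\<close>). They are
  divided by the 2048 units, and otherwise only by their own associates
  (\<open>balanced_multiple_iff\<close>), of which there are 320. This leaves \<open>4096 - 2048 - 320 = 1728\<close> characters
  without zeros on \<open>C\<close>.
\<close>

section \<open>Sums and traces of square matrices\<close>

lemma mat_mult_entry:
  fixes M :: "'a :: comm_semiring_0 mat"
  assumes "M \<in> carrier_mat n n" "M' \<in> carrier_mat n n" "i < n" "j < n"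
  shows "(M * M') $$ (i, j) = (\<Sum>k<n. M $$ (i, k) * M' $$ (k, j))"
  using assms by (auto simp: scalar_prod_def atLeast0LessThan)

text \<open>The sum is formed entrywise, since matrices of a fixed size do not form a type to which
  \<open>sum\<close> applies.\<close>

definition mat_sum :: "nat \<Rightarrow> ('b \<Rightarrow> 'a mat) \<Rightarrow> 'b set \<Rightarrow> 'a :: comm_monoid_add mat" where
  "mat_sum n F X = mat n n (\<lambda>(i, j). \<Sum>x\<in>X. F x $$ (i, j))"

lemma mat_sum_carrier [simp]: "mat_sum n F X \<in> carrier_mat n n"
  by (simp add: mat_sum_def)

lemma mat_sum_cong:
  "(\<And>x. x \<in> X \<Longrightarrow> F x = F' x) \<Longrightarrow> mat_sum n F X = mat_sum n F' X"
  by (simp add: mat_sum_def)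

lemma mat_sum_reindex:
  assumes "bij_betw h X Y"
  shows "mat_sum n (\<lambda>x. F (h x)) X = mat_sum n F Y"
  unfolding mat_sum_def using sum.reindex_bij_betw[OF assms] by (intro cong_mat) auto

lemma mat_sum_mult_left:
  fixes M :: "'a :: comm_semiring_0 mat"
  assumes M: "M \<in> carrier_mat n n" and F: "\<And>x. x \<in> X \<Longrightarrow> F x \<in> carrier_mat n n"
  shows "M * mat_sum n F X = mat_sum n (\<lambda>x. M * F x) X"
proof (rule eq_matI)
  fix i j assume "i < dim_row (mat_sum n (\<lambda>x. M * F x) X)" "j < dim_col (mat_sum n (\<lambda>x. M * F x) X)"
  then have ij: "i < n" "j < n" by (auto simp: mat_sum_def)
  have "(M * mat_sum n F X) $$ (i, j) = (\<Sum>k<n. M $$ (i, k) * (\<Sum>x\<in>X. F x $$ (k, j)))"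
    using M ij by (simp add: mat_mult_entry[of _ n]) (simp add: mat_sum_def)
  also have "\<dots> = (\<Sum>x\<in>X. \<Sum>k<n. M $$ (i, k) * F x $$ (k, j))"
    by (subst sum.swap) (simp add: sum_distrib_left)
  also have "\<dots> = (\<Sum>x\<in>X. (M * F x) $$ (i, j))"
    using M ij F by (intro sum.cong refl) (simp add: mat_mult_entry[of _ n])
  finally show "(M * mat_sum n F X) $$ (i, j) = mat_sum n (\<lambda>x. M * F x) X $$ (i, j)"
    using ij by (simp add: mat_sum_def)
qed (use M in \<open>auto simp: mat_sum_def\<close>)

lemma mat_sum_mult_right:
  fixes M :: "'a :: comm_semiring_0 mat"
  assumes M: "M \<in> carrier_mat n n" and F: "\<And>x. x \<in> X \<Longrightarrow> F x \<in> carrier_mat n n"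
  shows "mat_sum n F X * M = mat_sum n (\<lambda>x. F x * M) X"
proof (rule eq_matI)
  fix i j assume "i < dim_row (mat_sum n (\<lambda>x. F x * M) X)" "j < dim_col (mat_sum n (\<lambda>x. F x * M) X)"
  then have ij: "i < n" "j < n" by (auto simp: mat_sum_def)
  have "(mat_sum n F X * M) $$ (i, j) = (\<Sum>k<n. (\<Sum>x\<in>X. F x $$ (i, k)) * M $$ (k, j))"
    using M ij by (simp add: mat_mult_entry[of _ n]) (simp add: mat_sum_def)
  also have "\<dots> = (\<Sum>x\<in>X. \<Sum>k<n. F x $$ (i, k) * M $$ (k, j))"
    by (subst sum.swap) (simp add: sum_distrib_right)
  also have "\<dots> = (\<Sum>x\<in>X. (F x * M) $$ (i, j))"
    using M ij F by (intro sum.cong refl) (simp add: mat_mult_entry[of _ n])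
  finally show "(mat_sum n F X * M) $$ (i, j) = mat_sum n (\<lambda>x. F x * M) X $$ (i, j)"
    using ij by (simp add: mat_sum_def)
qed (use M in \<open>auto simp: mat_sum_def\<close>)

lemma mat_sum_smult:
  fixes P :: "'a :: comm_semiring_0 mat"
  assumes "P \<in> carrier_mat n n"
  shows "mat_sum n (\<lambda>x. c x \<cdot>\<^sub>m P) X = (\<Sum>x\<in>X. c x) \<cdot>\<^sub>m P"
  using assms by (intro eq_matI) (auto simp: mat_sum_def sum_distrib_right)

lemma mat_sum_smult_left:
  fixes F :: "'b \<Rightarrow> 'a :: comm_semiring_0 mat"
  assumes "\<And>x. x \<in> X \<Longrightarrow> F x \<in> carrier_mat n n"
  shows "mat_sum n (\<lambda>x. c \<cdot>\<^sub>m F x) X = c \<cdot>\<^sub>m mat_sum n F X"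
proof (rule eq_matI)
  fix i j assume "i < dim_row (c \<cdot>\<^sub>m mat_sum n F X)" "j < dim_col (c \<cdot>\<^sub>m mat_sum n F X)"
  then have ij: "i < n" "j < n" by (auto simp: mat_sum_def)
  have "(\<Sum>x\<in>X. (c \<cdot>\<^sub>m F x) $$ (i, j)) = (\<Sum>x\<in>X. c * F x $$ (i, j))"
    using ij assms by (intro sum.cong refl) (metis carrier_matD index_smult_mat(1))
  then show "mat_sum n (\<lambda>x. c \<cdot>\<^sub>m F x) X $$ (i, j) = (c \<cdot>\<^sub>m mat_sum n F X) $$ (i, j)"
    using ij by (simp add: mat_sum_def sum_distrib_left)
qed (auto simp: mat_sum_def)

lemma smult_smult_mat: "a \<cdot>\<^sub>m (b \<cdot>\<^sub>m M) = (a * b :: 'a :: semigroup_mult) \<cdot>\<^sub>m M"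
  by (intro eq_matI) (auto simp: mult.assoc)

lemma mat_trace_sum:
  assumes "\<And>x. x \<in> X \<Longrightarrow> F x \<in> carrier_mat n n"
  shows "mat_trace (mat_sum n F X) = (\<Sum>x\<in>X. mat_trace (F x))"
proof -
  have "mat_trace (mat_sum n F X) = (\<Sum>x\<in>X. \<Sum>i<n. F x $$ (i, i))"
    unfolding mat_trace_def mat_sum_def by (subst sum.swap) simp
  also have "\<dots> = (\<Sum>x\<in>X. mat_trace (F x))"
    using assms by (intro sum.cong refl) (auto simp: mat_trace_def)
  finally show ?thesis .
qed

lemma mat_trace_smult:
  fixes M :: "'a :: comm_semiring_0 mat"
  assumes "M \<in> carrier_mat n n"
  shows "mat_trace (c \<cdot>\<^sub>m M) = c * mat_trace M"
  using assms by (auto simp: mat_trace_def sum_distrib_left)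

lemma mat_trace_mult_commute:
  fixes M :: "'a :: comm_semiring_0 mat"
  assumes "M \<in> carrier_mat n n" "M' \<in> carrier_mat n n"
  shows "mat_trace (M * M') = mat_trace (M' * M)"
proof -
  have "mat_trace (M * M') = (\<Sum>i<n. \<Sum>j<n. M $$ (i, j) * M' $$ (j, i))"
    using assms by (auto simp: mat_trace_def scalar_prod_def atLeast0LessThan)
  also have "\<dots> = (\<Sum>j<n. \<Sum>i<n. M' $$ (j, i) * M $$ (i, j))"
    by (subst sum.swap) (simp add: mult.commute)
  also have "\<dots> = mat_trace (M' * M)"
    using assms by (auto simp: mat_trace_def scalar_prod_def atLeast0LessThan)
  finally show ?thesis .
qed

section \<open>Irreducible matrix representations\<close>

text \<open>Invertibility of the values need not be required: the value at the inverse element is an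
  inverse matrix.\<close>

lemma representation_iff:
  assumes "group G"
  shows "representation G n \<rho> \<longleftrightarrow>
    (\<forall>g\<in>carrier G. \<rho> g \<in> carrier_mat n n) \<and>
    (\<forall>g\<in>carrier G. \<forall>h\<in>carrier G. \<rho> (g \<otimes>\<^bsub>G\<^esub> h) = \<rho> g * \<rho> h) \<and>
    \<rho> \<one>\<^bsub>G\<^esub> = 1\<^sub>m n"
proof -
  interpret group G by fact
  let ?M = "ring_mat TYPE(complex) n ()"
  interpret M: ring ?M by (rule ring_mat)
  have units: "carrier (GL n) = Units ?M" "mult (GL n) = (*)" "one (GL n) = 1\<^sub>m n"
    by (simp_all add: units_of_def ring_mat_def)
  have Units_subset: "Units ?M \<subseteq> carrier_mat n n"
    by (auto simp: Units_def ring_mat_def)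
  show ?thesis
  proof
    assume "representation G n \<rho>"
    then have hom: "\<rho> \<in> hom G (GL n)" by (simp add: representation_def)
    interpret h: group_hom G "GL n" \<rho>
      by (intro group_hom.intro group_hom_axioms.intro hom is_group M.units_group)
    show "(\<forall>g\<in>carrier G. \<rho> g \<in> carrier_mat n n) \<and>
      (\<forall>g\<in>carrier G. \<forall>h\<in>carrier G. \<rho> (g \<otimes>\<^bsub>G\<^esub> h) = \<rho> g * \<rho> h) \<and> \<rho> \<one>\<^bsub>G\<^esub> = 1\<^sub>m n"
      using h.hom_one h.hom_mult h.hom_closed Units_subset by (auto simp: units)
  next
    assume *: "(\<forall>g\<in>carrier G. \<rho> g \<in> carrier_mat n n) \<and>
      (\<forall>g\<in>carrier G. \<forall>h\<in>carrier G. \<rho> (g \<otimes>\<^bsub>G\<^esub> h) = \<rho> g * \<rho> h) \<and> \<rho> \<one>\<^bsub>G\<^esub> = 1\<^sub>m n"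
    have "\<rho> g \<in> Units ?M" if g: "g \<in> carrier G" for g
    proof -
      have "\<rho> (inv\<^bsub>G\<^esub> g) * \<rho> g = 1\<^sub>m n" "\<rho> g * \<rho> (inv\<^bsub>G\<^esub> g) = 1\<^sub>m n"
        using * g by (metis inv_closed l_inv, metis inv_closed r_inv)
      then show ?thesis
        using * g inv_closed[OF g] by (auto simp: Units_def ring_mat_def)
    qed
    then show "representation G n \<rho>"
      using * by (auto simp: representation_def hom_def units)
  qed
qed

lemma invariant_subspace_iff:
  "invariant_subspace G n \<rho> W \<longleftrightarrow>
    W \<subseteq> carrier_vec n \<and> 0\<^sub>v n \<in> W \<and> (\<forall>u\<in>W. \<forall>w\<in>W. u + w \<in> W) \<and>
    (\<forall>c. \<forall>w\<in>W. c \<cdot>\<^sub>v w \<in> W) \<and> (\<forall>g\<in>carrier G. \<forall>w\<in>W. \<rho> g *\<^sub>v w \<in> W)"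
proof -
  interpret vec_space "TYPE(complex)" n .
  have "VectorSpace.subspace class_ring W (module_vec TYPE(complex) n) \<longleftrightarrow>
    W \<subseteq> carrier_vec n \<and> 0\<^sub>v n \<in> W \<and> (\<forall>u\<in>W. \<forall>w\<in>W. u + w \<in> W) \<and> (\<forall>c. \<forall>w\<in>W. c \<cdot>\<^sub>v w \<in> W)"
    unfolding VectorSpace.subspace_def submodule_def
    using vectorspace_axioms module_axioms
    by (auto simp: module_vec_simps class_ring_simps)
  then show ?thesis by (auto simp: invariant_subspace_def)
qed

text \<open>The vectors \<open>u\<close> with \<open>X \<rho>(g) u = 0\<close> for all \<open>g\<close> form an invariant subspace. When a given
  irreducible representation is analysed below, the absence of invariant subspaces is used only
  in this form, which takes the place of Schur's lemma.\<close>

lemma irreducible_annihilator: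
  assumes G: "group G" and irr: "irreducible_representation G n \<rho>"
    and X: "X \<in> carrier_mat n n" and w: "w \<in> carrier_vec n" "w \<noteq> 0\<^sub>v n"
    and ann: "\<And>g. g \<in> carrier G \<Longrightarrow> X *\<^sub>v (\<rho> g *\<^sub>v w) = 0\<^sub>v n"
  shows "X = 0\<^sub>m n n"
proof -
  interpret group G by fact
  have rep: "\<And>g. g \<in> carrier G \<Longrightarrow> \<rho> g \<in> carrier_mat n n"
    "\<And>g h. g \<in> carrier G \<Longrightarrow> h \<in> carrier G \<Longrightarrow> \<rho> (g \<otimes>\<^bsub>G\<^esub> h) = \<rho> g * \<rho> h" "\<rho> \<one>\<^bsub>G\<^esub> = 1\<^sub>m n"
    using irr by (auto simp: irreducible_representation_def representation_iff[OF G])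
  have act: "\<rho> g *\<^sub>v u \<in> carrier_vec n" if "g \<in> carrier G" "u \<in> carrier_vec n" for g u
    using mult_mat_vec_carrier[OF rep(1)] that by blast
  define W where "W = {u \<in> carrier_vec n. \<forall>g\<in>carrier G. X *\<^sub>v (\<rho> g *\<^sub>v u) = 0\<^sub>v n}"
  have "invariant_subspace G n \<rho> W"
    unfolding invariant_subspace_iff
  proof (intro conjI ballI allI)
    have zero: "M *\<^sub>v 0\<^sub>v n = 0\<^sub>v n" if "M \<in> carrier_mat n n" for M :: "complex mat"
      using that by (intro eq_vecI) auto
    show "0\<^sub>v n \<in> W" using zero[OF X] zero[OF rep(1)] by (simp add: W_def)
    show "u + u' \<in> W" if "u \<in> W" "u' \<in> W" for u u'
      using that X rep(1) by (auto simp: W_def act mult_add_distrib_mat_vec[of _ n n])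
    show "c \<cdot>\<^sub>v u \<in> W" if "u \<in> W" for c u
      using that X rep(1) by (auto simp: W_def act mult_mat_vec[of _ n n])
    show "\<rho> h *\<^sub>v u \<in> W" if h: "h \<in> carrier G" and u: "u \<in> W" for h u
    proof -
      have "X *\<^sub>v (\<rho> g *\<^sub>v (\<rho> h *\<^sub>v u)) = 0\<^sub>v n" if g: "g \<in> carrier G" for g
      proof -
        have "\<rho> g *\<^sub>v (\<rho> h *\<^sub>v u) = \<rho> (g \<otimes>\<^bsub>G\<^esub> h) *\<^sub>v u"
          using u rep(1)[OF g] rep(1)[OF h] by (subst rep(2)[OF g h]) (auto simp: W_def)
        then show ?thesis using u g h by (simp add: W_def)
      qed
      then show ?thesis using u rep(1)[OF h] by (auto simp: W_def)
    qed
  qed (auto simp: W_def)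
  then have "W = {0\<^sub>v n} \<or> W = carrier_vec n"
    using irr by (simp add: irreducible_representation_def)
  moreover have "w \<in> W" using w ann by (simp add: W_def)
  ultimately have "W = carrier_vec n" using w by auto
  then have zero: "X *\<^sub>v u = 0\<^sub>v n" if "u \<in> carrier_vec n" for u
  proof -
    have "u \<in> W" using \<open>W = carrier_vec n\<close> that by simp
    then have "X *\<^sub>v (\<rho> \<one>\<^bsub>G\<^esub> *\<^sub>v u) = 0\<^sub>v n" by (simp add: W_def)
    then show ?thesis using that rep(3) by simp
  qed
  show ?thesis
  proof (rule eq_matI)
    fix i j assume "i < dim_row (0\<^sub>m n n :: complex mat)" "j < dim_col (0\<^sub>m n n :: complex mat)"
    then have ij: "i < n" "j < n" by auto
    then have "X $$ (i, j) = (X *\<^sub>v unit_vec n j) $ i"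
      using X by (simp add: scalar_prod_right_unit[of j n] )
    then show "X $$ (i, j) = 0\<^sub>m n n $$ (i, j)" using zero[of "unit_vec n j"] ij by simp
  qed (use X in auto)
qed

lemma nonzero_matE:
  assumes "Y \<in> carrier_mat n n" "Y \<noteq> 0\<^sub>m n n"
  obtains i j where "i < n" "j < n" "Y $$ (i, j) \<noteq> 0"
  using assms by (metis carrier_matD eq_matI index_zero_mat)

text \<open>Apply \<open>irreducible_annihilator\<close> to a nonzero column of \<open>Y\<close>. The lemma serves to show that
  projectors which annihilate each other through the whole group cannot both be nonzero.\<close>

lemma irreducible_prime:
  assumes G: "group G" and irr: "irreducible_representation G n \<rho>"
    and X: "X \<in> carrier_mat n n" and Y: "Y \<in> carrier_mat n n"
    and ann: "\<And>g. g \<in> carrier G \<Longrightarrow> X * \<rho> g * Y = 0\<^sub>m n n"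
  shows "X = 0\<^sub>m n n \<or> Y = 0\<^sub>m n n"
proof (rule disjCI)
  assume "Y \<noteq> 0\<^sub>m n n"
  then obtain i j where ij: "i < n" "j < n" "Y $$ (i, j) \<noteq> 0" using nonzero_matE[OF Y] by blast
  have rep: "\<And>g. g \<in> carrier G \<Longrightarrow> \<rho> g \<in> carrier_mat n n"
    using irr by (auto simp: irreducible_representation_def representation_iff[OF G])
  show "X = 0\<^sub>m n n"
  proof (rule irreducible_annihilator[OF G irr X])
    show "col Y j \<in> carrier_vec n" using Y by auto
    have "col Y j $ i \<noteq> 0" using ij Y by auto
    then show "col Y j \<noteq> 0\<^sub>v n" using ij by auto
    show "X *\<^sub>v (\<rho> g *\<^sub>v col Y j) = 0\<^sub>v n" if g: "g \<in> carrier G" for g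
    proof -
      have "X *\<^sub>v (\<rho> g *\<^sub>v col Y j) = (X * \<rho> g) *\<^sub>v col Y j"
        using X rep[OF g] Y by (intro assoc_mult_mat_vec[symmetric]) auto
      also have "\<dots> = col (X * \<rho> g * Y) j"
        using X rep[OF g] Y ij by (intro col_mult2[symmetric, of _ n n _ n]) auto
      also have "\<dots> = 0\<^sub>v n" using ann[OF g] ij by (auto intro!: eq_vecI)
      finally show ?thesis .
    qed
  qed
qed

text \<open>An idempotent \<open>P\<close> for which every \<open>P \<rho>(g) P\<close> is a multiple of \<open>P\<close> has rank one. Indeed, let \<open>w\<close>
  be a nonzero vector in its image and \<open>Q\<close> a matrix with \<open>Q w = 0\<close>. Then \<open>Q P\<close> annihilates all
  \<open>\<rho>(g) w\<close>, hence it is zero; for a suitable \<open>Q\<close> this says that all columns of \<open>P\<close> are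
  multiples of \<open>w\<close>, and \<open>P w = w\<close> then makes the trace equal to one.\<close>

lemma irreducible_corner_trace:
  assumes G: "group G" and irr: "irreducible_representation G n \<rho>"
    and P: "P \<in> carrier_mat n n" "P \<noteq> 0\<^sub>m n n" "P * P = P"
    and corner: "\<And>g. g \<in> carrier G \<Longrightarrow> \<exists>c. P * \<rho> g * P = c \<cdot>\<^sub>m P"
  shows "mat_trace P = 1"
proof -
  obtain i k where ik: "i < n" "k < n" "P $$ (i, k) \<noteq> 0" using nonzero_matE[OF P(1,2)] by blast
  define w where "w = col P k"
  have w: "w \<in> carrier_vec n" "w $ i \<noteq> 0" using P ik by (auto simp: w_def)
  have Pw: "P *\<^sub>v w = w"
  proof -
    have "P *\<^sub>v w = col (P * P) k" using P(1) ik unfolding w_def by (intro eq_vecI) auto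
    then show ?thesis using P(3) by (simp add: w_def)
  qed
  have rep: "\<And>g. g \<in> carrier G \<Longrightarrow> \<rho> g \<in> carrier_mat n n"
    using irr by (auto simp: irreducible_representation_def representation_iff[OF G])
  \<comment> \<open>\<open>Q\<close> maps \<open>u\<close> to \<open>u - (u\<^sub>i / w\<^sub>i) w\<close>, so it vanishes on \<open>w\<close>\<close>
  define Q where "Q = mat n n (\<lambda>(j, l). (if j = l then 1 else 0) - (if l = i then w $ j / w $ i else 0))"
  have Q: "Q \<in> carrier_mat n n" by (simp add: Q_def)
  have Qv: "(Q *\<^sub>v u) $ j = u $ j - w $ j / w $ i * u $ i" if "u \<in> carrier_vec n" "j < n" for u j
  proof -
    have "(Q *\<^sub>v u) $ j = (\<Sum>l<n. ((if j = l then 1 else 0) - (if l = i then w $ j / w $ i else 0)) * u $ l)"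
      using that by (auto simp: Q_def scalar_prod_def atLeast0LessThan)
    also have "\<dots> = (\<Sum>l<n. if j = l then u $ l else 0) - (\<Sum>l<n. if l = i then w $ j / w $ i * u $ l else 0)"
      unfolding sum_subtractf[symmetric] by (intro sum.cong) (auto simp: algebra_simps)
    finally show ?thesis using that ik by simp
  qed
  have Qw: "Q *\<^sub>v w = 0\<^sub>v n"
  proof (rule eq_vecI)
    fix j assume "j < dim_vec (0\<^sub>v n :: complex vec)"
    then show "(Q *\<^sub>v w) $ j = 0\<^sub>v n $ j" using w by (simp add: Qv del: index_mult_mat_vec)
  qed (use Q in auto)
  have QP: "Q * P = 0\<^sub>m n n"
  proof (rule irreducible_annihilator[OF G irr])
    show "Q * P \<in> carrier_mat n n" using Q P by auto
    show "w \<noteq> 0\<^sub>v n" using w ik by auto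
    show "(Q * P) *\<^sub>v (\<rho> g *\<^sub>v w) = 0\<^sub>v n" if g: "g \<in> carrier G" for g
    proof -
      obtain c where c: "P * \<rho> g * P = c \<cdot>\<^sub>m P" using corner[OF g] by auto
      have "P *\<^sub>v (\<rho> g *\<^sub>v w) = P *\<^sub>v (\<rho> g *\<^sub>v (P *\<^sub>v w))" by (simp add: Pw)
      also have "\<dots> = (P * \<rho> g * P) *\<^sub>v w"
        using P rep[OF g] w by (simp add: assoc_mult_mat_vec[of _ n n _ n])
      also have "\<dots> = c \<cdot>\<^sub>v (P *\<^sub>v w)"
        using P w unfolding c by (intro eq_vecI) auto
      also have "\<dots> = c \<cdot>\<^sub>v w" by (simp add: Pw)
      finally have "(Q * P) *\<^sub>v (\<rho> g *\<^sub>v w) = Q *\<^sub>v (c \<cdot>\<^sub>v w)"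
        using P Q rep[OF g] w by (simp add: assoc_mult_mat_vec[of _ n n _ n])
      also have "\<dots> = 0\<^sub>v n" using Q w Qw by (auto simp: mult_mat_vec[of _ n n] intro!: eq_vecI)
      finally show ?thesis .
    qed
  qed (use w in auto)
  have row: "P $$ (j, l) = w $ j / w $ i * P $$ (i, l)" if "j < n" "l < n" for j l
  proof -
    have "(Q * P) $$ (j, l) = (Q *\<^sub>v col P l) $ j" using that P Q by auto
    also have "\<dots> = P $$ (j, l) - w $ j / w $ i * P $$ (i, l)"
      using that P ik by (subst Qv) auto
    finally show ?thesis using QP that by simp
  qed
  have "mat_trace P = (\<Sum>j<n. w $ j / w $ i * P $$ (i, j))"
    using P row by (auto simp: mat_trace_def)
  also have "\<dots> = (P *\<^sub>v w) $ i / w $ i"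
    using P w ik by (auto simp: scalar_prod_def atLeast0LessThan sum_divide_distrib mult.commute)
  finally show ?thesis using Pw w by simp
qed

section \<open>Elementary abelian 2-groups\<close>

instance bit :: finite
proof
  have "(UNIV :: bit set) = {0, 1}" by (auto intro: bit.exhaust)
  then show "finite (UNIV :: bit set)" by (metis finite.emptyI finite_insert)
qed

lemma card_UNIV_bit: "card (UNIV :: bit set) = 2"
proof -
  have "(UNIV :: bit set) = {0, 1}" by (auto intro: bit.exhaust)
  also have "card \<dots> = 2" by simp
  finally show ?thesis .
qed

text \<open>By default the simplifier turns sums and products of bits into bitwise operations, which
  hides the field structure needed here.\<close>

declare add_bit_eq_xor [simp del] mult_bit_eq_and [simp del]

class elementary_two_group = ab_group_add +
  assumes add_self: "x + x = 0"
begin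

lemma uminus_self: "- x = x"
  using add_self by (simp add: minus_unique)

lemma minus_eq_plus: "x - y = x + y"
  by (simp add: diff_conv_add_uminus uminus_self del: add_uminus_conv_diff)

lemma add_cancel_twice: "x + (x + y) = y" "(y + x) + x = y"
  by (simp_all add: add_self add.assoc) (simp add: add_self flip: add.assoc)

end

instance bit :: elementary_two_group
proof
  show "x + x = 0" for x :: bit by (cases x) simp_all
qed

instance prod :: (elementary_two_group, elementary_two_group) elementary_two_group
  by standard (auto simp: add_self prod_eq_iff)

instance "fun" :: (type, elementary_two_group) elementary_two_group
  by standard (simp add: add_self fun_eq_iff)

section \<open>Binary functions on a group and their characters\<close>

definition bsign :: "bit \<Rightarrow> complex" where
  "bsign b = (if b = 0 then 1 else - 1)"

lemma bsign_simps [simp]: "bsign 0 = 1" "bsign 1 = - 1"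
  by (simp_all add: bsign_def)

lemma bsign_add: "bsign (a + b) = bsign a * bsign b"
  by (cases a; cases b) simp_all

lemma bsign_mult_self [simp]: "bsign a * bsign a = 1" "bsign a * (bsign a * z) = z"
  by (cases a; simp)+

text \<open>A binary function \<open>U\<close> also denotes the character \<open>f \<mapsto> (-1)\<^bsup>\<langle>f, U\<rangle>\<^esup>\<close> of the additive group of binary
  functions; every character of that group is of this form.\<close>

definition pairing :: "('v :: finite \<Rightarrow> bit) \<Rightarrow> ('v \<Rightarrow> bit) \<Rightarrow> bit" where
  "pairing f U = (\<Sum>x\<in>UNIV. f x * U x)"

lemma pairing_simps [simp]: "pairing 0 U = 0" "pairing f 0 = 0"
  by (simp_all add: pairing_def)

lemma pairing_add: "pairing (f + g) U = pairing f U + pairing g U"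
  "pairing f (U + U') = pairing f U + pairing f U'"
  by (simp_all add: pairing_def sum.distrib algebra_simps)

lemma pairing_commute: "pairing f U = pairing U f"
  by (simp add: pairing_def mult.commute)

lemma pairing_bij:
  assumes "bij h"
  shows "pairing (\<lambda>x. f (h x)) (\<lambda>x. U (h x)) = pairing f U"
  unfolding pairing_def using sum.reindex_bij_betw[OF assms, of "\<lambda>x. f x * U x"] by simp

lemma bij_add_left: "bij (\<lambda>x. a + x :: 'a :: group_add)"
  by (intro bij_betwI[of _ _ _ "\<lambda>x. - a + x"]) (auto simp: add.assoc[symmetric])

lemma pairing_nondegenerate:
  assumes "U \<noteq> 0"
  obtains f where "pairing f U = 1"
proof -
  obtain x where x: "U x = 1" using assms by (auto simp: fun_eq_iff)
  have "pairing (\<lambda>y. if y = x then 1 else 0) U = (\<Sum>y\<in>UNIV. if y = x then U y else 0)"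
    unfolding pairing_def by (intro sum.cong) auto
  then show ?thesis using that x by simp
qed

text \<open>Adding to \<open>f\<close> a function that pairs to 1 with \<open>U\<close> flips all signs of the sum.\<close>

lemma sum_bsign_pairing:
  "(\<Sum>f\<in>UNIV. bsign (pairing f U)) = (if U = 0 then of_nat (card (UNIV :: ('v \<Rightarrow> bit) set)) else 0)"
  for U :: "'v :: finite \<Rightarrow> bit"
proof (cases "U = 0")
  case False
  then obtain e where e: "pairing e U = 1" by (rule pairing_nondegenerate)
  have "(\<Sum>f\<in>UNIV. bsign (pairing f U)) = (\<Sum>f\<in>UNIV. bsign (pairing (e + f) U))"
    using sum.reindex_bij_betw[OF bij_add_left, of "\<lambda>f. bsign (pairing f U)"] by simp
  also have "\<dots> = - (\<Sum>f\<in>UNIV. bsign (pairing f U))"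
    by (simp add: pairing_add e bsign_add sum_negf)
  finally show ?thesis using False by simp
qed simp

definition shift :: "'v :: ab_group_add \<Rightarrow> ('v \<Rightarrow> bit) \<Rightarrow> 'v \<Rightarrow> bit" where
  "shift v U = (\<lambda>x. U (x - v))"

lemma shift_0 [simp]: "shift 0 U = U"
  by (simp add: shift_def)

lemma shift_shift [simp]: "shift v (shift w U) = shift (v + w) U"
  by (simp add: shift_def diff_diff_eq)

lemma shift_add: "shift v (U + U') = shift v U + shift v U'"
  by (simp add: shift_def fun_eq_iff)

lemma shift_zero [simp]: "shift v 0 = 0"
  by (simp add: shift_def fun_eq_iff)

lemma bij_shift: "bij (shift v)"
  by (intro bij_betwI[of _ _ _ "shift (- v)"]) auto

lemma pairing_shift [simp]: "pairing (shift v f) (shift v U) = pairing f U"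
proof -
  have "bij (\<lambda>x. x - v)"
    by (intro bij_betwI[of _ _ _ "\<lambda>x. x + v"]) auto
  from pairing_bij[OF this] show ?thesis by (simp add: shift_def)
qed

lemma pairing_shift_left: "pairing (shift v f) U = pairing f (shift (- v) U)"
  using pairing_shift[of v f "shift (- v) U"] by simp

section \<open>Wreath products with the group of order two\<close>

text \<open>The elements of the wreath product are natural numbers that code pairs of a binary function
  on \<open>V\<close> and an element of \<open>V\<close>.\<close>

definition wr :: "('v :: finite \<Rightarrow> bit) \<Rightarrow> 'v \<Rightarrow> nat" where
  "wr f v = to_nat (f, v)"

definition base :: "nat \<Rightarrow> 'v :: finite \<Rightarrow> bit" where
  "base g = fst (from_nat g :: ('v \<Rightarrow> bit) \<times> 'v)"

definition top_part :: "nat \<Rightarrow> 'v :: finite" where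
  "top_part g = snd (from_nat g :: ('v \<Rightarrow> bit) \<times> 'v)"

lemma wr_simps [simp]: "base (wr f v) = f" "top_part (wr f v) = v"
  by (simp_all add: wr_def base_def top_part_def)

lemma wr_eq_iff [simp]: "wr f v = wr g w \<longleftrightarrow> f = g \<and> v = w"
  by (simp add: wr_def)

text \<open>The group \<open>C\<^sub>2 wr V\<close>: its base group consists of the binary functions on \<open>V\<close>, on which \<open>V\<close> acts by
  translation. The argument only carries the type of \<open>V\<close>.\<close>

definition wreath :: "'v :: {finite, ab_group_add} itself \<Rightarrow> nat monoid" where
  "wreath T =
    \<lparr>carrier = {wr f v | f (v :: 'v). True},
     mult = (\<lambda>x y. wr (base x + shift (top_part x) (base y)) (top_part x + top_part y :: 'v)),
     one = wr 0 (0 :: 'v)\<rparr>"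

lemma wreath_simps [simp]:
  "carrier (wreath TYPE('v :: {finite, ab_group_add})) = {wr f v | f (v :: 'v). True}"
  "wr f v \<otimes>\<^bsub>wreath TYPE('v)\<^esub> wr g (w :: 'v) = wr (f + shift v g) (v + w)"
  "\<one>\<^bsub>wreath TYPE('v)\<^esub> = wr 0 (0 :: 'v)"
  by (simp_all add: wreath_def)

lemma group_wreath: "group (wreath TYPE('v :: {finite, ab_group_add}))"
proof (rule groupI)
  fix x assume "x \<in> carrier (wreath TYPE('v))"
  then obtain f v where "x = wr f (v :: 'v)" by auto
  then show "\<exists>y\<in>carrier (wreath TYPE('v)). y \<otimes>\<^bsub>wreath TYPE('v)\<^esub> x = \<one>\<^bsub>wreath TYPE('v)\<^esub>"
    by (auto intro!: exI[of _ "wr (shift (- v) f) (- v)"] simp: add_self)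
qed (auto simp: add.assoc shift_add)

lemma order_wreath:
  "Coset.order (wreath TYPE('v :: {finite, ab_group_add})) = 2 ^ card (UNIV :: 'v set) * card (UNIV :: 'v set)"
proof -
  have "{wr f v | f (v :: 'v). True} = (\<lambda>(f, v :: 'v). wr f v) ` UNIV"
    by (auto simp: image_iff)
  moreover have "inj (\<lambda>(f, v). wr f (v :: 'v))" by (auto intro!: injI)
  ultimately have "Coset.order (wreath TYPE('v)) = card (UNIV :: (('v \<Rightarrow> bit) \<times> 'v) set)"
    by (simp add: Coset.order_def card_image)
  also have "\<dots> = card (UNIV :: ('v \<Rightarrow> bit) set) * card (UNIV :: 'v set)"
    by (metis UNIV_Times_UNIV card_cartesian_product)
  also have "card (UNIV :: ('v \<Rightarrow> bit) set) = 2 ^ card (UNIV :: 'v set)"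
    by (simp add: card_fun card_UNIV_bit)
  finally show ?thesis .
qed

section \<open>Irreducible characters induced from the base group\<close>

definition translates :: "('v :: ab_group_add \<Rightarrow> bit) \<Rightarrow> ('v \<Rightarrow> bit) set" where
  "translates U = range (\<lambda>v. shift v U)"

lemma translates_self [simp]: "U \<in> translates U"
  by (auto simp: translates_def intro: image_eqI[of _ _ 0])

lemma translates_eq: "U' \<in> translates U \<Longrightarrow> translates U' = translates U"
proof -
  assume "U' \<in> translates U"
  then obtain v where v: "U' = shift v U" by (auto simp: translates_def)
  have "shift w U = shift (w - v) U'" "shift w U' = shift (w + v) U" for w
    by (simp_all add: v)
  then show ?thesis unfolding translates_def by (metis (no_types, lifting) image_cong rangeE rangeI subsetI subset_antisym)
qed

lemma shift_in_translates_iff [simp]: "shift v U \<in> translates W \<longleftrightarrow> U \<in> translates W"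
proof -
  have "translates (shift v U) = translates U"
    by (rule translates_eq) (auto simp: translates_def)
  then show ?thesis using translates_eq translates_self by metis
qed

text \<open>The linear character \<open>S\<close> of the base group extends to its stabiliser in the wreath product, with
  value 1 on the stabiliser of \<open>S\<close> in \<open>V\<close>; this is the character induced from that extension. The
  induced representation has a basis indexed by the translates of \<open>S\<close>, and \<open>(f, v)\<close> sends the basis
  vector of \<open>U\<close> to \<open>(-1)\<^bsup>\<langle>f, v + U\<rangle>\<^esup>\<close> times the basis vector of the translate \<open>v + U\<close>, so that only
  the \<open>U\<close> fixed by \<open>v\<close> contribute to the trace.\<close>

definition orbit_character :: "('v :: {finite, ab_group_add} \<Rightarrow> bit) \<Rightarrow> nat \<Rightarrow> complex" where
  "orbit_character S = (\<lambda>g\<in>carrier (wreath TYPE('v)).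
    \<Sum>U\<in>translates S. if shift (top_part g) U = U then bsign (pairing (base g) U) else 0)"

lemma orbit_character_wr:
  fixes S :: "'v :: {finite, ab_group_add} \<Rightarrow> bit" and v :: 'v
  shows "orbit_character S (wr f v) = (\<Sum>U\<in>translates S. if shift v U = U then bsign (pairing f U) else 0)"
  by (auto simp: orbit_character_def cong: if_cong)

lemma sum_vec_in_invariant_subspace:
  assumes W: "invariant_subspace G n \<rho> W" and "finite X" "\<And>x. x \<in> X \<Longrightarrow> F x \<in> W"
  shows "vec n (\<lambda>i. \<Sum>x\<in>X. F x $ i) \<in> W"
  using assms(2,3)
proof (induction X rule: finite_induct)
  case empty
  have "vec n (\<lambda>i. \<Sum>x\<in>{}. F x $ i) = 0\<^sub>v n" by (intro eq_vecI) auto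
  then show ?case using W by (simp add: invariant_subspace_iff)
next
  case (insert x X)
  have "F x \<in> carrier_vec n" using insert W by (auto simp: invariant_subspace_iff)
  then have "vec n (\<lambda>i. \<Sum>x\<in>insert x X. F x $ i) = F x + vec n (\<lambda>i. \<Sum>x\<in>X. F x $ i)"
    using insert by (intro eq_vecI) auto
  then show ?case using insert W by (simp add: invariant_subspace_iff)
qed

text \<open>The basis vectors have distinct weights under the base group. A Fourier projection therefore
  isolates a basis vector from any nonzero vector of an invariant subspace, and \<open>V\<close> permutes the
  basis vectors transitively up to sign.\<close>

lemma orbit_character_in_Irr:
  fixes S :: "'v :: {finite, ab_group_add} \<Rightarrow> bit"
  shows "orbit_character S \<in> Irr (wreath TYPE('v))"
proof -
  let ?G = "wreath TYPE('v)"
  \<comment> \<open>rows and columns are indexed by the positions in an enumeration of the orbit\<close>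
  obtain us where us: "set us = translates S" "distinct us"
    using finite_distinct_list[of "translates S"] by auto
  define n where "n = length us"
  define M where "M f v = mat n n (\<lambda>(i, j). if us ! i = shift v (us ! j) then bsign (pairing f (us ! i)) else 0)"
    for f and v :: 'v
  define \<rho> where "\<rho> g = M (base g) (top_part g)" for g
  have M_carrier: "M f v \<in> carrier_mat n n" for f v by (simp add: M_def)
  have index: "\<exists>!k. k < n \<and> us ! k = U" if "U \<in> translates S" for U
    using that us by (metis distinct_Ex1 n_def)
  have nth_in: "us ! i \<in> translates S" if "i < n" for i
    using that us n_def nth_mem by metis
  have nth_eq: "us ! i = us ! j \<longleftrightarrow> i = j" if "i < n" "j < n" for i j
    using that us nth_eq_iff_index_eq by (auto simp: n_def)
  have n_pos: "0 < n" using index[OF translates_self] by auto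
  have mult: "M f v * M g w = M (f + shift v g) (v + w)" for f v g w
  proof (rule eq_matI)
    fix i j assume "i < dim_row (M (f + shift v g) (v + w))" "j < dim_col (M (f + shift v g) (v + w))"
    then have ij: "i < n" "j < n" by (auto simp: M_def)
    obtain k where k: "k < n" "us ! k = shift w (us ! j)"
      using index[of "shift w (us ! j)"] nth_in[OF ij(2)] by auto
    have "(M f v * M g w) $$ (i, j) = (\<Sum>l<n. M f v $$ (i, l) * M g w $$ (l, j))"
      by (rule mat_mult_entry[OF M_carrier M_carrier ij])
    also have "\<dots> = (\<Sum>l<n. if l = k then M f v $$ (i, l) * bsign (pairing g (us ! k)) else 0)"
      using ij k nth_eq[OF _ k(1)] by (intro sum.cong refl) (auto simp: M_def simp flip: k(2))
    also have "\<dots> = M f v $$ (i, k) * bsign (pairing g (us ! k))"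
      using k by simp
    also have "\<dots> = M (f + shift v g) (v + w) $$ (i, j)"
      using ij k by (auto simp: M_def pairing_add bsign_add pairing_shift_left)
    finally show "(M f v * M g w) $$ (i, j) = M (f + shift v g) (v + w) $$ (i, j)" .
  qed (auto simp: M_def)
  have one: "M 0 0 = 1\<^sub>m n"
    using nth_eq by (intro eq_matI) (auto simp: M_def)
  have rep: "representation ?G n \<rho>"
    by (auto simp: representation_iff[OF group_wreath] \<rho>_def M_carrier mult one)
  have act: "M f v *\<^sub>v unit_vec n j = bsign (pairing f (us ! i)) \<cdot>\<^sub>v unit_vec n i"
    if "i < n" "j < n" "us ! i = shift v (us ! j)" for f v i j
  proof (rule eq_vecI)
    fix k assume "k < dim_vec (bsign (pairing f (us ! i)) \<cdot>\<^sub>v unit_vec n i :: complex vec)"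
    then have "k < n" by simp
    then show "(M f v *\<^sub>v unit_vec n j) $ k = (bsign (pairing f (us ! i)) \<cdot>\<^sub>v unit_vec n i) $ k"
      using that nth_eq[of k i] by (auto simp: M_def)
  qed (auto simp: M_def)
  have irr: "irreducible_representation ?G n \<rho>"
    unfolding irreducible_representation_def
  proof (intro conjI rep n_pos allI impI)
    fix W assume W: "invariant_subspace ?G n \<rho> W"
    have W_sub: "W \<subseteq> carrier_vec n" and W_smult: "\<And>c w. w \<in> W \<Longrightarrow> c \<cdot>\<^sub>v w \<in> W"
      and W_zero: "0\<^sub>v n \<in> W"
      and W_\<rho>: "\<And>g w. g \<in> carrier ?G \<Longrightarrow> w \<in> W \<Longrightarrow> \<rho> g *\<^sub>v w \<in> W"
      using W by (auto simp: invariant_subspace_iff)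
    have W_act: "M f v *\<^sub>v w \<in> W" if "w \<in> W" for f v w
      using W_\<rho>[of "wr f v", OF _ that] by (auto simp: \<rho>_def)
    show "W = {0\<^sub>v n} \<or> W = carrier_vec n"
    proof (rule disjCI)
      assume "W \<noteq> carrier_vec n"
      show "W = {0\<^sub>v n}"
      proof (rule ccontr)
        assume "W \<noteq> {0\<^sub>v n}"
        then obtain w where w: "w \<in> W" "w \<noteq> 0\<^sub>v n" using W_zero by auto
        then have wc: "w \<in> carrier_vec n" using W_sub by auto
        then obtain i where i: "i < n" "w $ i \<noteq> 0" using w by (metis carrier_vecD eq_vecI index_zero_vec)
        let ?N = "of_nat (card (UNIV :: ('v \<Rightarrow> bit) set)) :: complex"
        \<comment> \<open>up to a factor, the projection of \<open>w\<close> to the weight space of \<open>us ! i\<close>\<close>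
        define u where "u = vec n (\<lambda>k. \<Sum>f\<in>UNIV. (bsign (pairing f (us ! i)) \<cdot>\<^sub>v (M f 0 *\<^sub>v w)) $ k)"
        have "u \<in> W"
          unfolding u_def by (rule sum_vec_in_invariant_subspace[OF W]) (auto intro: W_act W_smult w)
        moreover have "u = (?N * w $ i) \<cdot>\<^sub>v unit_vec n i"
        proof (rule eq_vecI)
          fix k assume "k < dim_vec ((?N * w $ i) \<cdot>\<^sub>v unit_vec n i)"
          then have k: "k < n" by simp
          have Mw: "(M f 0 *\<^sub>v w) $ k = bsign (pairing f (us ! k)) * w $ k" for f
          proof -
            have "(M f 0 *\<^sub>v w) $ k = (\<Sum>l<n. M f 0 $$ (k, l) * w $ l)"
              using k wc by (auto simp: M_def scalar_prod_def atLeast0LessThan)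
            also have "\<dots> = (\<Sum>l<n. if l = k then bsign (pairing f (us ! k)) * w $ l else 0)"
              using k nth_eq by (intro sum.cong refl) (auto simp: M_def)
            finally show ?thesis using k by simp
          qed
          have "u $ k = (\<Sum>f\<in>UNIV. bsign (pairing f (us ! i)) * (bsign (pairing f (us ! k)) * w $ k))"
            using k by (simp add: u_def Mw carrier_matD(1)[OF M_carrier] del: index_mult_mat_vec(1))
          also have "\<dots> = (\<Sum>f\<in>UNIV. bsign (pairing f (us ! i + us ! k))) * w $ k"
            by (simp add: sum_distrib_right pairing_add bsign_add mult.assoc)
          also have "\<dots> = (if us ! i = us ! k then ?N * w $ k else 0)"
            unfolding sum_bsign_pairing by (auto simp: add_self) (metis add_cancel_twice(1) add.right_neutral)
          finally show "u $ k = ((?N * w $ i) \<cdot>\<^sub>v unit_vec n i) $ k"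
            using k i nth_eq[of i k] by auto
        qed (simp add: u_def)
        ultimately have "(1 / (?N * w $ i)) \<cdot>\<^sub>v ((?N * w $ i) \<cdot>\<^sub>v unit_vec n i) \<in> W"
          using W_smult by metis
        then have ei: "unit_vec n i \<in> W"
          using i by (simp add: smult_smult_assoc)
        have ej: "unit_vec n j \<in> W" if j: "j < n" for j
        proof -
          obtain v where v: "us ! j = shift v (us ! i)"
            using nth_in[OF j] translates_eq[OF nth_in[OF i(1)]] by (auto simp: translates_def)
          then show ?thesis using W_act[OF ei, of 0 v] act[OF j i(1) v, of 0] by simp
        qed
        have "u \<in> W" if u: "u \<in> carrier_vec n" for u
        proof -
          have "vec n (\<lambda>k. \<Sum>j<n. (u $ j \<cdot>\<^sub>v unit_vec n j) $ k) \<in> W"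
            by (rule sum_vec_in_invariant_subspace[OF W]) (auto intro: W_smult ej)
          also have "vec n (\<lambda>k. \<Sum>j<n. (u $ j \<cdot>\<^sub>v unit_vec n j) $ k) = u"
          proof (rule eq_vecI)
            fix k assume "k < dim_vec u"
            then have k: "k < n" using u by simp
            have "(\<Sum>j<n. (u $ j \<cdot>\<^sub>v unit_vec n j) $ k) = (\<Sum>j<n. if j = k then u $ j else 0)"
              using k by (intro sum.cong) auto
            then show "vec n (\<lambda>k. \<Sum>j<n. (u $ j \<cdot>\<^sub>v unit_vec n j) $ k) $ k = u $ k"
              using k by simp
          qed (use u in simp)
          finally show ?thesis .
        qed
        then show False using \<open>W \<noteq> carrier_vec n\<close> W_sub by auto
      qed
    qed
  qed
  have "character_of ?G \<rho> = orbit_character S"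
  proof
    fix g
    show "character_of ?G \<rho> g = orbit_character S g"
    proof (cases "g \<in> carrier ?G")
      case True
      then obtain f v where g: "g = wr f (v :: 'v)" by auto
      have "character_of ?G \<rho> g = (\<Sum>i<n. if us ! i = shift v (us ! i) then bsign (pairing f (us ! i)) else 0)"
        using True by (auto simp: character_of_def \<rho>_def g mat_trace_def M_def cong: if_cong)
      also have "\<dots> = (\<Sum>U\<in>translates S. if U = shift v U then bsign (pairing f U) else 0)"
        using us by (intro sum.reindex_bij_betw bij_betw_nth) (auto simp: n_def)
      also have "\<dots> = orbit_character S g"
        by (auto simp: orbit_character_wr g intro!: sum.cong)
      finally show ?thesis .
    qed (auto simp: character_of_def orbit_character_def)
  qed
  then show ?thesis using irr unfolding Irr_def by force
qed

text \<open>Up to the order of the base group, the left-hand side is the multiplicity of the weight \<open>U\<close>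
  in the restriction to the base group. The character thus determines the orbit of \<open>S\<close>.\<close>

lemma weight_multiplicity_orbit_character:
  fixes S :: "'v :: {finite, ab_group_add} \<Rightarrow> bit"
  shows "(\<Sum>f\<in>UNIV. bsign (pairing f U) * orbit_character S (wr f 0)) =
    (if U \<in> translates S then of_nat (card (UNIV :: ('v \<Rightarrow> bit) set)) else 0)"
proof -
  have eq: "U + U' = 0 \<longleftrightarrow> U' = U" for U' :: "'v \<Rightarrow> bit"
    by (metis add_cancel_twice(1) add.right_neutral add_self)
  have "(\<Sum>f\<in>UNIV. bsign (pairing f U) * orbit_character S (wr f 0)) =
    (\<Sum>f\<in>UNIV. \<Sum>U'\<in>translates S. bsign (pairing f (U + U')))"
    by (simp add: orbit_character_wr sum_distrib_left pairing_add bsign_add)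
  also have "\<dots> = (\<Sum>U'\<in>translates S. if U' = U then of_nat (card (UNIV :: ('v \<Rightarrow> bit) set)) else 0)"
    by (subst sum.swap) (simp add: sum_bsign_pairing eq)
  finally show ?thesis by simp
qed

lemma orbit_character_eqD:
  assumes "orbit_character S = orbit_character S'"
  shows "S' \<in> translates S"
  using weight_multiplicity_orbit_character[of S' S] weight_multiplicity_orbit_character[of S' S'] assms
  by (simp split: if_splits)

lemma orbit_character_base:
  fixes S :: "'v :: {finite, ab_group_add} \<Rightarrow> bit"
  shows "orbit_character S (wr T 0) = (\<Sum>U\<in>translates S. bsign (pairing T U))"
  by (simp add: orbit_character_wr)

text \<open>Summing over \<open>V\<close> instead of the orbit counts every translate as often as the stabiliser of \<open>S\<close>
  has elements. The advantage of the sum over \<open>V\<close> is that its terms are the signs of the values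
  of a convolution product of \<open>T\<close> and \<open>S\<close>.\<close>

lemma orbit_character_base_eq_0_iff:
  fixes S :: "'v :: {finite, ab_group_add} \<Rightarrow> bit"
  shows "orbit_character S (wr T 0) = 0 \<longleftrightarrow> (\<Sum>v\<in>UNIV. bsign (pairing T (shift v S))) = 0"
proof -
  let ?H = "{v. shift v S = S}"
  have fibre: "card {v. shift v S = U} = card ?H" if U: "U \<in> translates S" for U
  proof -
    obtain x where x: "U = shift x S" using U by (auto simp: translates_def)
    have "shift (x + v) S = U \<longleftrightarrow> shift v S = S" for v
    proof -
      have "shift (x + v) S = shift x (shift v S)" by simp
      then show ?thesis using bij_shift[of x] by (simp add: x bij_is_inj inj_eq del: shift_shift)
    qed
    then have "(\<lambda>v. x + v) ` ?H = {v. shift v S = U}"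
    proof (intro equalityI subsetI)
      fix w assume "w \<in> {v. shift v S = U}"
      then have "shift (x + (- x + w)) S = U" by simp
      then have "- x + w \<in> ?H"
        using \<open>\<And>v. shift (x + v) S = U \<longleftrightarrow> shift v S = S\<close> by blast
      then show "w \<in> (\<lambda>v. x + v) ` ?H"
        by (rule image_eqI[rotated]) simp
    qed auto
    then have "bij_betw (\<lambda>v. x + v) ?H {v. shift v S = U}"
      by (simp add: bij_betw_def)
    from bij_betw_same_card[OF this] show ?thesis by (rule sym)
  qed
  have "(\<Sum>v\<in>UNIV. bsign (pairing T (shift v S))) =
    (\<Sum>U\<in>translates S. \<Sum>v\<in>{v. shift v S = U}. bsign (pairing T (shift v S)))"
    using sum.image_gen[of UNIV "\<lambda>v. bsign (pairing T (shift v S))" "\<lambda>v. shift v S"]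
    by (simp add: translates_def)
  also have "\<dots> = (\<Sum>U\<in>translates S. of_nat (card ?H) * bsign (pairing T U))"
  proof (rule sum.cong[OF refl])
    fix U assume U: "U \<in> translates S"
    have "(\<Sum>v\<in>{v. shift v S = U}. bsign (pairing T (shift v S))) =
      (\<Sum>v\<in>{v. shift v S = U}. bsign (pairing T U))"
      by (rule sum.cong) auto
    then show "(\<Sum>v\<in>{v. shift v S = U}. bsign (pairing T (shift v S))) =
        of_nat (card ?H) * bsign (pairing T U)"
      unfolding fibre[OF U, symmetric] by simp
  qed
  also have "\<dots> = of_nat (card ?H) * orbit_character S (wr T 0)"
    by (simp add: orbit_character_base sum_distrib_left)
  finally have "(\<Sum>v\<in>UNIV. bsign (pairing T (shift v S))) = of_nat (card ?H) * orbit_character S (wr T 0)" .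
  moreover have "of_nat (card ?H) \<noteq> (0 :: complex)" by (auto simp: card_eq_0_iff intro: exI[of _ 0])
  ultimately show ?thesis by (metis mult_eq_0_iff)
qed

section \<open>Weights of an irreducible representation of a wreath product\<close>

text \<open>The parameter \<open>T\<close> ties the locale to the type of \<open>V\<close>.\<close>

locale irreducible_wreath =
  fixes n :: nat and \<rho> :: "nat \<Rightarrow> complex mat"
    and T :: "'v :: {finite, elementary_two_group} itself"
  assumes irr: "irreducible_representation (wreath TYPE('v)) n \<rho>"
begin

definition R :: "('v \<Rightarrow> bit) \<Rightarrow> 'v \<Rightarrow> complex mat" where
  "R f v = \<rho> (wr f v)"

lemma rep:
  "g \<in> carrier (wreath TYPE('v)) \<Longrightarrow> \<rho> g \<in> carrier_mat n n"
  "g \<in> carrier (wreath TYPE('v)) \<Longrightarrow> h \<in> carrier (wreath TYPE('v)) \<Longrightarrow>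
    \<rho> (g \<otimes>\<^bsub>wreath TYPE('v)\<^esub> h) = \<rho> g * \<rho> h"
  "\<rho> \<one>\<^bsub>wreath TYPE('v)\<^esub> = 1\<^sub>m n"
  using irr unfolding irreducible_representation_def representation_iff[OF group_wreath] by blast+

lemma square_carrier [simp]:
  fixes A B :: "complex mat"
  assumes "A \<in> carrier_mat n n" "B \<in> carrier_mat n n"
  shows "A * B \<in> carrier_mat n n" "A + B \<in> carrier_mat n n" "A - B \<in> carrier_mat n n"
  using assms by (auto simp: minus_carrier_mat)

lemmas square_assoc = assoc_mult_mat[of _ n n _ n _ n]
lemmas square_smult = mult_smult_distrib[of _ n n _ n] mult_smult_assoc_mat[of _ n n _ n] smult_smult_mat
lemma square_smult_zero:
  "c \<cdot>\<^sub>m (0\<^sub>m n n :: complex mat) = 0\<^sub>m n n"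
  "A \<in> carrier_mat n n \<Longrightarrow> 0 \<cdot>\<^sub>m A = (0\<^sub>m n n :: complex mat)"
  "A \<in> carrier_mat n n \<Longrightarrow> 1 \<cdot>\<^sub>m A = (A :: complex mat)"
  by (auto intro!: eq_matI)

lemmas square_neutral = left_mult_one_mat[of _ n n] right_mult_one_mat[of _ n n]
  left_mult_zero_mat[of _ n n] right_mult_zero_mat[of _ n n]

lemma n_pos: "0 < n"
  using irr by (simp add: irreducible_representation_def)

lemma R_carrier [simp]: "R f v \<in> carrier_mat n n"
  unfolding R_def by (rule rep) auto

lemma R_mult: "R f v * R g w = R (f + shift v g) (v + w)"
  using rep(2)[of "wr f v" "wr g w"] by (auto simp: R_def)

lemma R_one: "R 0 0 = 1\<^sub>m n"
  using rep(3) by (simp add: R_def)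

lemma R_split: "R f v = R f 0 * R 0 v"
  by (simp add: R_mult)

text \<open>The projector to the space on which the base group acts through the character \<open>U\<close>, obtained
  by Fourier inversion.\<close>

definition weight_projector :: "('v \<Rightarrow> bit) \<Rightarrow> complex mat" where
  "weight_projector U = mat_sum n (\<lambda>f. (bsign (pairing f U) / of_nat CARD('v \<Rightarrow> bit)) \<cdot>\<^sub>m R f 0) UNIV"

lemma weight_projector_carrier [simp]: "weight_projector U \<in> carrier_mat n n"
  by (simp add: weight_projector_def)

lemma square_dims [simp]:
  "dim_row (R f v) = n" "dim_col (R f v) = n"
  "dim_row (weight_projector U) = n" "dim_col (weight_projector U) = n"
  using R_carrier weight_projector_carrier by blast+

lemma base_mult_weight_projector:
  "R f 0 * weight_projector U = bsign (pairing f U) \<cdot>\<^sub>m weight_projector U" (is ?left)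
  and weight_projector_mult_base:
  "weight_projector U * R f 0 = bsign (pairing f U) \<cdot>\<^sub>m weight_projector U" (is ?right)
proof -
  let ?c = "\<lambda>g. bsign (pairing g U) / of_nat CARD('v \<Rightarrow> bit)"
  have eq: "mat_sum n (\<lambda>g. ?c g \<cdot>\<^sub>m R (f + g) 0) UNIV = bsign (pairing f U) \<cdot>\<^sub>m weight_projector U"
  proof -
    have "mat_sum n (\<lambda>g. ?c g \<cdot>\<^sub>m R (f + g) 0) UNIV =
      mat_sum n (\<lambda>g. bsign (pairing f U) \<cdot>\<^sub>m (?c (f + g) \<cdot>\<^sub>m R (f + g) 0)) UNIV"
      by (intro mat_sum_cong eq_matI) (simp_all add: pairing_add bsign_add)
    also have "\<dots> = mat_sum n (\<lambda>g. bsign (pairing f U) \<cdot>\<^sub>m (?c g \<cdot>\<^sub>m R g 0)) UNIV"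
      by (rule mat_sum_reindex[OF bij_add_left])
    also have "\<dots> = bsign (pairing f U) \<cdot>\<^sub>m weight_projector U"
      by (subst mat_sum_smult_left) (simp_all add: weight_projector_def)
    finally show ?thesis .
  qed
  have smult: "R f 0 * (c \<cdot>\<^sub>m R g 0) = c \<cdot>\<^sub>m R (f + g) 0" "(c \<cdot>\<^sub>m R g 0) * R f 0 = c \<cdot>\<^sub>m R (f + g) 0" for c g
    by (simp_all add: square_smult R_mult add.commute)
  show ?left
    unfolding eq[symmetric] unfolding weight_projector_def
    by (subst mat_sum_mult_left) (auto simp: smult intro!: mat_sum_cong)
  show ?right
    unfolding eq[symmetric] unfolding weight_projector_def
    by (subst mat_sum_mult_right) (auto simp: smult intro!: mat_sum_cong)
qed

lemma weight_projector_orthogonal: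
  "weight_projector U * weight_projector U' = (if U = U' then weight_projector U else 0\<^sub>m n n)"
proof -
  have zero: "U + U' = 0 \<longleftrightarrow> U = U'"
    by (metis add_cancel_twice(1) add.right_neutral add_self)
  have "weight_projector U * weight_projector U' =
    mat_sum n (\<lambda>f. ((bsign (pairing f U) / of_nat CARD('v \<Rightarrow> bit)) \<cdot>\<^sub>m R f 0) * weight_projector U') UNIV"
    by (subst (1) weight_projector_def) (simp add: mat_sum_mult_right)
  also have "\<dots> = mat_sum n (\<lambda>f. (bsign (pairing f (U + U')) / of_nat CARD('v \<Rightarrow> bit)) \<cdot>\<^sub>m weight_projector U') UNIV"
    by (intro mat_sum_cong)
      (simp add: square_smult base_mult_weight_projector
        pairing_add bsign_add)
  also have "\<dots> = (\<Sum>f\<in>UNIV. bsign (pairing f (U + U')) / of_nat CARD('v \<Rightarrow> bit)) \<cdot>\<^sub>m weight_projector U'"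
    by (simp add: mat_sum_smult)
  also have "(\<Sum>f\<in>UNIV. bsign (pairing f (U + U')) / of_nat CARD('v \<Rightarrow> bit)) = (if U = U' then 1 else 0)"
    by (simp add: sum_divide_distrib[symmetric] sum_bsign_pairing zero)
  finally show ?thesis by (simp add: square_smult_zero)
qed

lemma sum_weight_projector: "mat_sum n weight_projector UNIV = 1\<^sub>m n"
proof (rule eq_matI)
  fix i j assume "i < dim_row (1\<^sub>m n :: complex mat)" "j < dim_col (1\<^sub>m n :: complex mat)"
  then have ij: "i < n" "j < n" by auto
  have smult: "(c \<cdot>\<^sub>m R f 0) $$ (i, j) = c * R f 0 $$ (i, j)" for c f
    using ij by (metis R_carrier carrier_matD index_smult_mat(1))
  have "mat_sum n weight_projector UNIV $$ (i, j) =
    (\<Sum>U\<in>UNIV. \<Sum>f\<in>UNIV. bsign (pairing f U) / of_nat CARD('v \<Rightarrow> bit) * R f 0 $$ (i, j))"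
    using ij by (simp add: mat_sum_def weight_projector_def smult)
  also have "\<dots> = (\<Sum>f\<in>UNIV. (\<Sum>U\<in>UNIV. bsign (pairing U f)) / of_nat CARD('v \<Rightarrow> bit) * R f 0 $$ (i, j))"
    by (subst sum.swap) (simp add: sum_distrib_right sum_divide_distrib pairing_commute)
  also have "\<dots> = (\<Sum>f\<in>UNIV. if f = 0 then R f 0 $$ (i, j) else 0)"
    by (intro sum.cong) (auto simp: sum_bsign_pairing)
  also have "\<dots> = 1\<^sub>m n $$ (i, j)" by (simp add: R_one)
  finally show "mat_sum n weight_projector UNIV $$ (i, j) = 1\<^sub>m n $$ (i, j)" .
qed (auto simp: mat_sum_def)

lemma top_mult_weight_projector:
  "R 0 v * weight_projector U = weight_projector (shift v U) * R 0 v"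
proof -
  let ?c = "\<lambda>U f. bsign (pairing f U) / of_nat CARD('v \<Rightarrow> bit)"
  have "R 0 v * weight_projector U = mat_sum n (\<lambda>f. R 0 v * (?c U f \<cdot>\<^sub>m R f 0)) UNIV"
    by (simp add: weight_projector_def mat_sum_mult_left)
  also have "\<dots> = mat_sum n (\<lambda>f. (?c (shift v U) (shift v f) \<cdot>\<^sub>m R (shift v f) 0) * R 0 v) UNIV"
    by (intro mat_sum_cong)
      (simp add: square_smult R_mult)
  also have "\<dots> = mat_sum n (\<lambda>f. (?c (shift v U) f \<cdot>\<^sub>m R f 0) * R 0 v) UNIV"
    by (rule mat_sum_reindex[OF bij_shift])
  also have "\<dots> = weight_projector (shift v U) * R 0 v"
    by (simp add: weight_projector_def mat_sum_mult_right)
  finally show ?thesis .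
qed

text \<open>An element \<open>v\<close> carries the weight space of \<open>U\<close> to that of its translate by \<open>v\<close>, and different
  weight spaces are orthogonal.\<close>

lemma weight_projector_corner:
  "weight_projector W * R f v * weight_projector U =
    (if W = shift v U then bsign (pairing f W) \<cdot>\<^sub>m (R 0 v * weight_projector U) else 0\<^sub>m n n)"
proof -
  let ?P = weight_projector
  have "?P W * R f v * ?P U = (?P W * R f 0) * (R 0 v * ?P U)"
    by (subst R_split) (simp add: square_assoc )
  also have "\<dots> = bsign (pairing f W) \<cdot>\<^sub>m ((?P W * ?P (shift v U)) * R 0 v)"
    by (simp add: weight_projector_mult_base top_mult_weight_projector square_smult
        square_assoc)
  finally show ?thesis
    by (simp add: weight_projector_orthogonal top_mult_weight_projector square_neutral square_smult_zero)
qed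

lemma weight_exists: "\<exists>U. weight_projector U \<noteq> 0\<^sub>m n n"
proof (rule ccontr)
  assume "\<not> ?thesis"
  then have "1\<^sub>m n = mat_sum n (\<lambda>U :: 'v \<Rightarrow> bit. 0\<^sub>m n n :: complex mat) UNIV"
    using sum_weight_projector by (metis mat_sum_cong)
  then have "(1\<^sub>m n :: complex mat) $$ (0, 0) = 0"
    using n_pos by (simp add: mat_sum_def)
  then show False using n_pos by simp
qed

text \<open>By \<open>weight_projector_corner\<close> the projectors of two weights in different orbits annihilate each
  other through the whole group, which \<open>irreducible_prime\<close> forbids for nonzero ones.\<close>

lemma weights_are_translates:
  assumes "weight_projector U \<noteq> 0\<^sub>m n n"
  shows "weight_projector W \<noteq> 0\<^sub>m n n \<longleftrightarrow> W \<in> translates U"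
proof
  assume W: "weight_projector W \<noteq> 0\<^sub>m n n"
  show "W \<in> translates U"
  proof (rule ccontr)
    assume not: "W \<notin> translates U"
    have "weight_projector W = 0\<^sub>m n n \<or> weight_projector U = 0\<^sub>m n n"
    proof (rule irreducible_prime[OF group_wreath irr])
      fix g assume "g \<in> carrier (wreath TYPE('v))"
      then obtain f v where "g = wr f (v :: 'v)" by auto
      then show "weight_projector W * \<rho> g * weight_projector U = 0\<^sub>m n n"
        using weight_projector_corner[of W f v U] not by (auto simp: translates_def R_def)
    qed auto
    then show False using assms W by simp
  qed
next
  assume "W \<in> translates U"
  then obtain v where v: "W = shift v U" by (auto simp: translates_def)
  show "weight_projector W \<noteq> 0\<^sub>m n n"
  proof
    assume "weight_projector W = 0\<^sub>m n n"
    then have "R 0 v * weight_projector U = 0\<^sub>m n n"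
      using top_mult_weight_projector[of v U] v by (simp add: square_neutral)
    then have "R 0 (- v) * (R 0 v * weight_projector U) = 0\<^sub>m n n" by (simp add: square_neutral)
    then have "(R 0 (- v) * R 0 v) * weight_projector U = 0\<^sub>m n n"
      by (simp add: square_assoc)
    then show False using assms by (simp add: R_mult R_one square_neutral)
  qed
qed

text \<open>On the weight space, \<open>v\<close> acts as an involution that commutes with the whole stabiliser, so the
  projections \<open>X\<close> and \<open>Y\<close> to its two eigenspaces (up to scalars) annihilate each other through
  the group. By \<open>irreducible_prime\<close> one eigenspace is zero.\<close>

lemma stabiliser_scalar:
  assumes U: "weight_projector U \<noteq> 0\<^sub>m n n" and v: "shift v U = U"
  shows "\<exists>c\<in>{1, - 1}. R 0 v * weight_projector U = c \<cdot>\<^sub>m weight_projector U"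
proof -
  let ?P = "weight_projector U"
  define X Y where "X = R 0 v * ?P - ?P" and "Y = R 0 v * ?P + ?P"
  have XY: "X \<in> carrier_mat n n" "Y \<in> carrier_mat n n" by (simp_all add: X_def Y_def)
  have RP: "R 0 w * ?P = ?P * R 0 w" if "shift w U = U" for w
    using top_mult_weight_projector[of w U] that by simp
  have PP: "?P * ?P = ?P" by (simp add: weight_projector_orthogonal)
  have sq: "R 0 v * (R 0 v * A) = A" if "A \<in> carrier_mat n n" for A
  proof -
    have "R 0 v * (R 0 v * A) = (R 0 v * R 0 v) * A"
      using that by (simp add: square_assoc)
    then show ?thesis using that by (simp add: R_mult add_self R_one square_neutral)
  qed
  have PX: "X = (R 0 v - 1\<^sub>m n) * ?P" and PY: "Y = ?P * (R 0 v + 1\<^sub>m n)"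
    by (simp_all add: X_def Y_def square_neutral minus_mult_distrib_mat[of _ n n _ _ n] mult_add_distrib_mat[of _ n n _ n] RP[OF v])
  have "X = 0\<^sub>m n n \<or> Y = 0\<^sub>m n n"
  proof (rule irreducible_prime[OF group_wreath irr XY])
    fix g assume "g \<in> carrier (wreath TYPE('v))"
    then obtain f w where g: "g = wr f (w :: 'v)" by auto
    have "X * R f w * Y = (R 0 v - 1\<^sub>m n) * (?P * R f w * ?P) * (R 0 v + 1\<^sub>m n)"
      unfolding PX PY by (simp add: square_assoc)
    also have "\<dots> = 0\<^sub>m n n"
    proof (cases "shift w U = U")
      case True
      have comm: "R 0 v * R 0 w = R 0 w * R 0 v" by (simp add: R_mult add.commute)
      have "(R 0 v - 1\<^sub>m n) * (R 0 w * ?P) * (R 0 v + 1\<^sub>m n) = (R 0 v - 1\<^sub>m n) * (R 0 w * Y)"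
        unfolding PY by (simp add: square_assoc)
      also have "\<dots> = R 0 v * (R 0 w * Y) - R 0 w * Y"
        using XY by (simp add: minus_mult_distrib_mat[of _ n n _ _ n] square_neutral)
      also have "R 0 v * (R 0 w * Y) = R 0 w * (R 0 v * Y)"
        using XY comm by (simp flip: square_assoc)
      also have "R 0 v * Y = Y"
        unfolding Y_def by (subst mult_add_distrib_mat[of _ n n _ n]) (simp_all add: sq comm_add_mat[of _ n n])
      also have "R 0 w * Y - R 0 w * Y = 0\<^sub>m n n"
        using XY by (simp add: minus_r_inv_mat[of _ n n])
      finally have "(R 0 v - 1\<^sub>m n) * (R 0 w * ?P) * (R 0 v + 1\<^sub>m n) = 0\<^sub>m n n" .
      then show ?thesis using True
        by (simp add: weight_projector_corner square_smult)
    next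
      case False
      then have "U \<noteq> shift w U" by metis
      then show ?thesis by (simp add: weight_projector_corner)
    qed
    finally show "X * \<rho> g * Y = 0\<^sub>m n n" by (simp add: g R_def)
  qed
  then show ?thesis
  proof
    assume X0: "X = 0\<^sub>m n n"
    have "R 0 v * ?P = X + ?P" unfolding X_def
      by (intro eq_matI) (auto simp del: index_mult_mat(1))
    then have "R 0 v * ?P = 1 \<cdot>\<^sub>m ?P" using X0 by (auto intro!: eq_matI)
    then show ?thesis by blast
  next
    assume Y0: "Y = 0\<^sub>m n n"
    have "R 0 v * ?P = Y - ?P" unfolding Y_def
      by (intro eq_matI) (auto simp del: index_mult_mat(1))
    then have "R 0 v * ?P = (- 1) \<cdot>\<^sub>m ?P" using Y0 by (auto intro!: eq_matI)
    then show ?thesis by blast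
  qed
qed

text \<open>The weight spaces are one-dimensional, because the stabiliser acts on them by scalars.\<close>

lemma trace_weight_projector:
  assumes U: "weight_projector U \<noteq> 0\<^sub>m n n"
  shows "mat_trace (weight_projector U) = 1"
proof (rule irreducible_corner_trace[OF group_wreath irr _ U])
  fix g assume "g \<in> carrier (wreath TYPE('v))"
  then obtain f v where g: "g = wr f (v :: 'v)" by auto
  show "\<exists>c. weight_projector U * \<rho> g * weight_projector U = c \<cdot>\<^sub>m weight_projector U"
  proof (cases "shift v U = U")
    case True
    then obtain c where "R 0 v * weight_projector U = c \<cdot>\<^sub>m weight_projector U"
      using stabiliser_scalar[OF U] by blast
    then show ?thesis
      using True weight_projector_corner[of U f v U] by (auto simp: g R_def square_smult)
  next
    case False
    then have "weight_projector U * R f v * weight_projector U = 0 \<cdot>\<^sub>m weight_projector U"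
      by (subst weight_projector_corner) (auto simp: square_smult_zero)
    then show ?thesis by (auto simp: g R_def)
  qed
qed (auto simp: weight_projector_orthogonal)

text \<open>If \<open>U\<close> is a weight and \<open>v\<close> stabilises it, this is the scalar by which \<open>v\<close> acts on the
  weight space.\<close>

definition weight_trace :: "('v \<Rightarrow> bit) \<Rightarrow> 'v \<Rightarrow> complex" where
  "weight_trace U v = mat_trace (weight_projector U * R 0 v)"

lemma weight_trace_moved:
  assumes "shift v U \<noteq> U"
  shows "weight_trace U v = 0"
proof -
  let ?P = weight_projector
  have "?P U * R 0 v = ?P U * (?P U * R 0 v)"
    by (simp add: square_assoc[symmetric] weight_projector_orthogonal)
  then have "weight_trace U v = mat_trace ((?P U * R 0 v) * ?P U)"
    unfolding weight_trace_def by (metis mat_trace_mult_commute mult_carrier_mat R_carrier weight_projector_carrier)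
  also have "(?P U * R 0 v) * ?P U = 0\<^sub>m n n"
    using assms weight_projector_corner[of U 0 v U] by auto
  finally show ?thesis by (simp add: mat_trace_def)
qed

lemma weight_trace_shift: "weight_trace (shift w U) v = weight_trace U v"
proof -
  let ?P = weight_projector
  have inv: "R 0 (- w) * R 0 w = 1\<^sub>m n" "R 0 w * R 0 (- w) = 1\<^sub>m n" by (simp_all add: R_mult R_one)
  have "?P (shift w U) = ?P (shift w U) * (R 0 w * R 0 (- w))" by (simp add: inv square_neutral)
  also have "\<dots> = R 0 w * (?P U * R 0 (- w))"
    by (simp add: square_assoc[symmetric] top_mult_weight_projector)
  finally have "weight_trace (shift w U) v = mat_trace (R 0 w * (?P U * R 0 (- w) * R 0 v))"
    by (simp add: weight_trace_def square_assoc)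
  also have "\<dots> = mat_trace ((?P U * R 0 (- w) * R 0 v) * R 0 w)"
    by (rule mat_trace_mult_commute[of _ n]) simp_all
  also have "(?P U * R 0 (- w) * R 0 v) * R 0 w = ?P U * R 0 v"
    by (simp add: square_assoc R_mult)
  finally show ?thesis by (simp add: weight_trace_def)
qed

lemma weight_trace_scalar:
  assumes "weight_projector U \<noteq> 0\<^sub>m n n" "shift v U = U" "R 0 v * weight_projector U = c \<cdot>\<^sub>m weight_projector U"
  shows "weight_trace U v = c"
  using assms top_mult_weight_projector[of v U]
  by (simp add: weight_trace_def mat_trace_smult[of _ n] trace_weight_projector)

lemma weight_trace_hom:
  assumes U: "weight_projector U \<noteq> 0\<^sub>m n n" and v: "shift v U = U" and w: "shift w U = U"
  shows "weight_trace U (v + w) = weight_trace U v * weight_trace U w"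
proof -
  let ?P = "weight_projector U"
  obtain c where c: "R 0 v * ?P = c \<cdot>\<^sub>m ?P" using stabiliser_scalar[OF U v] by blast
  obtain d where d: "R 0 w * ?P = d \<cdot>\<^sub>m ?P" using stabiliser_scalar[OF U w] by blast
  have "R 0 (v + w) * ?P = R 0 v * (R 0 w * ?P)"
    by (simp add: square_assoc[symmetric] R_mult)
  also have "\<dots> = (c * d) \<cdot>\<^sub>m ?P"
    by (simp add: d c square_smult mult.commute)
  finally have "R 0 (v + w) * ?P = (c * d) \<cdot>\<^sub>m ?P" .
  moreover have "shift (v + w) U = U" using v w by (metis shift_shift)
  ultimately show ?thesis
    using weight_trace_scalar[OF U] v w c d by metis
qed

lemma weight_trace_square:
  assumes U: "weight_projector U \<noteq> 0\<^sub>m n n" and v: "shift v U = U"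
  shows "weight_trace U v * weight_trace U v = 1"
  using stabiliser_scalar[OF assms] weight_trace_scalar[OF assms] by auto

lemma character_wr: "character_of (wreath TYPE('v)) \<rho> (wr f v) = mat_trace (R f v)"
  by (auto simp: character_of_def R_def)

text \<open>Split the identity matrix into the weight projectors.\<close>

lemma character_eq_sum_weight_trace:
  "character_of (wreath TYPE('v)) \<rho> (wr f v) = (\<Sum>U\<in>UNIV. bsign (pairing f U) * weight_trace U v)"
proof -
  have "R f v = mat_sum n weight_projector UNIV * R f v" by (simp add: sum_weight_projector square_neutral)
  also have "\<dots> = mat_sum n (\<lambda>U. weight_projector U * R f v) UNIV"
    by (simp add: mat_sum_mult_right)
  also have "\<dots> = mat_sum n (\<lambda>U. bsign (pairing f U) \<cdot>\<^sub>m (weight_projector U * R 0 v)) UNIV"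
  proof (rule mat_sum_cong)
    fix U
    have "weight_projector U * R f v = (weight_projector U * R f 0) * R 0 v"
      by (subst R_split) (simp add: square_assoc)
    then show "weight_projector U * R f v = bsign (pairing f U) \<cdot>\<^sub>m (weight_projector U * R 0 v)"
      by (simp add: weight_projector_mult_base square_smult)
  qed
  finally show ?thesis
    by (simp add: character_wr mat_trace_sum mat_trace_smult[of _ n] weight_trace_def)
qed

text \<open>By Fourier inversion the character determines the weights and the scalars on the weight spaces,
  so these inherit every symmetry of the character.\<close>

lemma weight_trace_eq_sum_character:
  "weight_trace U v = (\<Sum>f\<in>UNIV. bsign (pairing f U) * character_of (wreath TYPE('v)) \<rho> (wr f v)) / of_nat CARD('v \<Rightarrow> bit)"
proof -
  have "weight_projector U * R 0 v =
    mat_sum n (\<lambda>f. (bsign (pairing f U) / of_nat CARD('v \<Rightarrow> bit)) \<cdot>\<^sub>m R f 0 * R 0 v) UNIV"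
    by (simp add: weight_projector_def mat_sum_mult_right)
  also have "\<dots> = mat_sum n (\<lambda>f. (bsign (pairing f U) / of_nat CARD('v \<Rightarrow> bit)) \<cdot>\<^sub>m R f v) UNIV"
    by (intro mat_sum_cong) (simp add: square_smult R_mult)
  finally show ?thesis
    by (simp add: weight_trace_def mat_trace_sum mat_trace_smult[of _ n] character_wr sum_divide_distrib)
qed

lemma weight_projector_eq_0_iff:
  "weight_projector U = 0\<^sub>m n n \<longleftrightarrow> weight_trace U 0 = 0"
proof -
  have "weight_trace U 0 = mat_trace (weight_projector U)"
    by (simp add: weight_trace_def R_one square_neutral)
  then show ?thesis
    using trace_weight_projector[of U] by (cases "weight_projector U = 0\<^sub>m n n") (simp_all add: mat_trace_def)
qed

end

section \<open>Fixed-point-free automorphisms and invariant characters\<close>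

text \<open>The acting group consists of the powers of \<open>\<alpha>\<close>, and \<open>m\<close> is its order.\<close>

locale fpf_automorphism =
  fixes \<alpha> :: "'v :: {finite, elementary_two_group} \<Rightarrow> 'v" and m :: nat
  assumes add: "\<alpha> (x + y) = \<alpha> x + \<alpha> y"
    and fpf: "\<alpha> x = x \<Longrightarrow> x = 0"
    and period: "\<alpha> ^^ m = id"
    and faithful: "k < m \<Longrightarrow> \<alpha> ^^ k = id \<Longrightarrow> k = 0"
    and m_gt_1: "1 < m"
begin

abbreviation \<beta> :: "'v \<Rightarrow> 'v" where
  "\<beta> \<equiv> inv_into UNIV \<alpha>"

lemma bij_alpha: "bij \<alpha>"
proof -
  obtain k where "m = Suc k" using m_gt_1 by (cases m) auto
  then have Suc: "\<alpha> ^^ Suc k = id" using period by (simp only:)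
  then have "\<alpha> \<circ> \<alpha> ^^ k = id" by (simp only: funpow.simps)
  moreover have "\<alpha> ^^ k \<circ> \<alpha> = id" using Suc by (simp only: funpow_Suc_right)
  ultimately show ?thesis by (metis o_bij)
qed

lemma alpha_zero [simp]: "\<alpha> 0 = 0"
  using add[of 0 0] by simp

lemma inv_alpha [simp]: "\<alpha> (\<beta> x) = x" "\<beta> (\<alpha> x) = x"
  using bij_alpha by (simp_all add: bij_is_inj bij_is_surj surj_f_inv_f)

lemma inv_alpha_diff: "\<beta> (x - \<alpha> v) = \<beta> x - v"
proof -
  have "\<alpha> (\<beta> x - v) = x - \<alpha> v"
    by (simp add: minus_eq_plus add)
  then show ?thesis by (metis inv_alpha(2))
qed

text \<open>The action of \<open>\<alpha>\<close> on functions, normalised by \<open>push f (\<alpha> x) = f x\<close>.\<close>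

definition push :: "('v \<Rightarrow> bit) \<Rightarrow> 'v \<Rightarrow> bit" where
  "push f = f \<circ> \<beta>"

lemma bij_push: "bij push"
  by (intro bij_betwI[of _ _ _ "\<lambda>f. f \<circ> \<alpha>"]) (auto simp: push_def fun_eq_iff)

lemma push_eq_iff [simp]: "push f = push g \<longleftrightarrow> f = g"
  using bij_push by (auto dest: bij_is_inj injD)

lemma push_fixed_iff: "push f = f \<longleftrightarrow> (\<forall>x. f (\<alpha> x) = f x)"
proof
  assume f: "push f = f"
  have "push f (\<alpha> x) = f x" for x by (simp add: push_def)
  then show "\<forall>x. f (\<alpha> x) = f x" using f by simp
next
  assume f: "\<forall>x. f (\<alpha> x) = f x"
  have "push f x = f x" for x using spec[OF f, of "\<beta> x"] by (simp add: push_def)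
  then show "push f = f" by (rule ext)
qed

lemma push_add: "push (f + g) = push f + push g"
  by (simp add: push_def fun_eq_iff)

lemma push_zero [simp]: "push 0 = 0"
  by (simp add: push_def fun_eq_iff)

lemma push_shift: "push (shift v U) = shift (\<alpha> v) (push U)"
  by (simp add: push_def shift_def fun_eq_iff inv_alpha_diff)

lemma pairing_push: "pairing (push f) (push U) = pairing f U"
  using pairing_bij[OF bij_imp_bij_inv[OF bij_alpha], of f U] by (simp add: push_def comp_def)

text \<open>In characteristic two \<open>x \<mapsto> \<alpha> x + x\<close> is the map \<open>\<alpha> - 1\<close>, whose kernel is the set of fixed points.\<close>

lemma inj_commutator: "inj (\<lambda>x. \<alpha> x + x)"
proof (rule injI)
  fix x y assume eq: "\<alpha> x + x = \<alpha> y + y"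
  have "\<alpha> (x + y) = (\<alpha> x + x) + (x + \<alpha> y)"
    by (simp add: add add.assoc add_cancel_twice)
  also have "\<dots> = x + y"
    unfolding eq by (simp add: add_ac add_self add_cancel_twice)
  finally have "x + y = 0" by (rule fpf)
  then show "x = y" by (metis add_cancel_twice(1) add.right_neutral)
qed

lemma commutator_surj: obtains x where "\<alpha> x + x = v"
proof -
  have "surj (\<lambda>x. \<alpha> x + x)" using finite_UNIV_inj_surj[OF _ inj_commutator] by simp
  then show ?thesis using that by (auto elim: surjE[of _ v])
qed

text \<open>The stabiliser of \<open>S\<close> is finite and mapped into itself by the injective map \<open>\<alpha> - 1\<close>, so
  it is mapped onto itself.\<close>

lemma commutator_stabiliser:
  assumes S: "push S = S" and v: "shift v S = S"
  obtains w where "shift w S = S" "\<alpha> w + w = v"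
proof -
  let ?H = "{w. shift w S = S}"
  have "\<alpha> w + w \<in> ?H" if "w \<in> ?H" for w
  proof -
    have "shift (\<alpha> w) S = S" using push_shift[of w S] that S by simp
    then show ?thesis using that by (simp flip: shift_shift)
  qed
  then have "(\<lambda>x. \<alpha> x + x) ` ?H = ?H"
    by (intro endo_inj_surj) (auto intro: inj_on_subset[OF inj_commutator])
  then show ?thesis using v that by (metis (mono_tags, lifting) imageE mem_Collect_eq)
qed

text \<open>This lemma and the next one are the instance of Glauberman's lemma that is needed: an orbit of
  \<open>V\<close> which \<open>\<alpha>\<close> preserves contains exactly one fixed point. If \<open>\<alpha>\<close> sends \<open>U\<close> to its translate by \<open>v\<close>
  and \<open>\<alpha> x + x = v\<close>, then it fixes the translate of \<open>U\<close> by \<open>x\<close>.\<close>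

lemma fixed_translate_exists:
  assumes "push U \<in> translates U"
  obtains S where "S \<in> translates U" "push S = S"
proof -
  obtain v where v: "push U = shift v U" using assms by (auto simp: translates_def)
  obtain x where x: "\<alpha> x + x = v" by (rule commutator_surj)
  have "push (shift x U) = shift x U"
    unfolding push_shift v shift_shift x[symmetric] by (simp add: add_cancel_twice)
  then show ?thesis using that[of "shift x U"] by simp
qed

text \<open>If \<open>S\<close> and its translate by \<open>v\<close> are both fixed, then \<open>\<alpha> v + v\<close> stabilises \<open>S\<close>; as \<open>\<alpha> - 1\<close> is
  injective and maps the stabiliser onto itself, \<open>v\<close> stabilises \<open>S\<close> as well.\<close>

lemma fixed_translate_unique:
  assumes S: "push S = S" and S': "push S' = S'" and tr: "S' \<in> translates S"
  shows "S' = S"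
proof -
  obtain v where v: "S' = shift v S" using tr by (auto simp: translates_def)
  have "shift (\<alpha> v) S = shift v S" using push_shift[of v S] S S' v by simp
  then have "shift v (shift (\<alpha> v) S) = shift v (shift v S)" by simp
  then have "shift (\<alpha> v + v) S = S" by (simp add: add_self add.commute)
  then obtain w where w: "shift w S = S" "\<alpha> w + w = \<alpha> v + v"
    using commutator_stabiliser[OF S] by blast
  then have "w = v" using injD[OF inj_commutator, of w v] by simp
  then show ?thesis using v w by simp
qed

lemma push_in_translates_iff:
  assumes "push S = S"
  shows "push U \<in> translates S \<longleftrightarrow> U \<in> translates S"
proof
  assume "U \<in> translates S"
  then show "push U \<in> translates S"
    using push_shift assms by (auto simp: translates_def)
next
  assume "push U \<in> translates S"
  then obtain v where "push U = shift v S" by (auto simp: translates_def)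
  then have "push U = push (shift (\<beta> v) S)" using push_shift assms by simp
  then show "U \<in> translates S" by (simp add: translates_def)
qed

lemma orbit_character_push:
  assumes S: "push S = S"
  shows "orbit_character S (wr (push f) (\<alpha> v)) = orbit_character S (wr f v)"
proof -
  have "bij_betw push (translates S) (translates S)"
  proof (rule bij_betwI[of _ _ _ "inv_into UNIV push"])
    show "inv_into UNIV push \<in> translates S \<rightarrow> translates S"
      using push_in_translates_iff[OF S] bij_push by (metis Pi_I bij_is_surj surj_f_inv_f)
  qed (use push_in_translates_iff[OF S] bij_push in \<open>auto simp: bij_is_inj bij_is_surj surj_f_inv_f\<close>)
  from sum.reindex_bij_betw[OF this, of
      "\<lambda>U. if shift (\<alpha> v) U = U then bsign (pairing (push f) U) else 0", symmetric]
  show ?thesis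
    by (simp add: orbit_character_wr pairing_push flip: push_shift cong: if_cong)
qed

text \<open>Since the character is invariant, \<open>\<alpha>\<close> permutes the weights. They form one orbit of \<open>V\<close>, which
  therefore contains a fixed weight \<open>S\<close>. The scalars by which the stabiliser of \<open>S\<close> acts on the weight
  space of \<open>S\<close> form an \<open>\<alpha>\<close>-invariant homomorphism to the signs. Every element of the stabiliser is
  of the form \<open>\<alpha> w + w\<close> with \<open>w\<close> in the stabiliser, so its scalar is a square, that is, 1. This
  determines all terms of \<open>character_eq_sum_weight_trace\<close>.\<close>

lemma invariant_character_is_orbit_character:
  assumes irr: "irreducible_representation (wreath TYPE('v)) n \<rho>"
    and inv: "\<And>f v. character_of (wreath TYPE('v)) \<rho> (wr (push f) (\<alpha> v)) =
      character_of (wreath TYPE('v)) \<rho> (wr f v)"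
  shows "\<exists>S. push S = S \<and> character_of (wreath TYPE('v)) \<rho> = orbit_character S"
proof -
  interpret irreducible_wreath n \<rho> "TYPE('v)" by standard (rule irr)
  have wt: "weight_trace (push U) (\<alpha> v) = weight_trace U v" for U v
    using sum.reindex_bij_betw[OF bij_push, of
      "\<lambda>f. bsign (pairing f (push U)) * character_of (wreath TYPE('v)) \<rho> (wr f (\<alpha> v))"]
    by (simp add: weight_trace_eq_sum_character pairing_push inv)
  obtain U where U: "weight_projector U \<noteq> 0\<^sub>m n n" using weight_exists by blast
  have "weight_projector (push U) \<noteq> 0\<^sub>m n n"
    using U wt[of U 0] by (simp add: weight_projector_eq_0_iff)
  then have "push U \<in> translates U" using weights_are_translates[OF U] by simp
  then obtain S where S: "S \<in> translates U" "push S = S" by (rule fixed_translate_exists)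
  have P_S: "weight_projector S \<noteq> 0\<^sub>m n n" using weights_are_translates[OF U] S by simp
  have one: "weight_trace S v = 1" if v: "shift v S = S" for v
  proof -
    obtain w where w: "shift w S = S" "\<alpha> w + w = v"
      using commutator_stabiliser[OF S(2) v] by blast
    have "shift (\<alpha> w) S = S" using push_shift[of w S] S(2) w by simp
    then have "weight_trace S v = weight_trace S (\<alpha> w) * weight_trace S w"
      using weight_trace_hom[OF P_S] w by metis
    also have "weight_trace S (\<alpha> w) = weight_trace S w" using wt[of S w] S(2) by simp
    finally show ?thesis using weight_trace_square[OF P_S w(1)] by simp
  qed
  have wt_eq: "weight_trace U' v = (if shift v U' = U' then 1 else 0)" if U': "U' \<in> translates S" for U' v
  proof -
    obtain x where x: "U' = shift x S" using U' by (auto simp: translates_def)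
    have "shift v S = S" if "shift v U' = U'"
    proof -
      have "shift (- x) (shift v (shift x S)) = shift (- x) (shift x S)" using that x by simp
      then show ?thesis by simp
    qed
    then show ?thesis using one[of v] weight_trace_moved[of v U'] weight_trace_shift[of x S v] x by metis
  qed
  have wt_zero: "weight_trace U' v = 0" if "U' \<notin> translates S" for U' v
    using that weights_are_translates[OF P_S, of U']
    by (simp add: weight_trace_def square_neutral mat_trace_def)
  have eq: "character_of (wreath TYPE('v)) \<rho> (wr f v) = orbit_character S (wr f v)" for f and v :: 'v
    unfolding character_eq_sum_weight_trace orbit_character_wr
    by (rule sum.mono_neutral_cong_right) (auto simp: wt_zero wt_eq)
  have "character_of (wreath TYPE('v)) \<rho> = orbit_character S"
  proof
    fix g show "character_of (wreath TYPE('v)) \<rho> g = orbit_character S g"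
    proof (cases "g \<in> carrier (wreath TYPE('v))")
      case True
      then show ?thesis using eq by auto
    qed (auto simp: character_of_def orbit_character_def)
  qed
  then show ?thesis using S by blast
qed

lemma invariant_irreducible_characters:
  "{\<chi> \<in> Irr (wreath TYPE('v)). \<forall>f v. \<chi> (wr (push f) (\<alpha> v)) = \<chi> (wr f v)} =
    orbit_character ` {S. push S = S}"
  using invariant_character_is_orbit_character orbit_character_in_Irr orbit_character_push
  by (fastforce simp: Irr_def)

lemma inj_orbit_character: "inj_on orbit_character {S. push S = S}"
  by (rule inj_onI) (metis (mono_tags) mem_Collect_eq orbit_character_eqD fixed_translate_unique)

section \<open>The cyclic group of automorphisms of the wreath product\<close>

definition act :: "nat \<Rightarrow> nat \<Rightarrow> nat" where
  "act k g = wr ((push ^^ k) (base g)) ((\<alpha> ^^ k) (top_part g))"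

text \<open>Restricted to the carrier, because automorphism groups consist of extensional functions.\<close>

definition action :: "int \<Rightarrow> nat \<Rightarrow> nat" where
  "action a = restrict (act (nat a)) (carrier (wreath TYPE('v)))"

lemma act_wr [simp]: "act k (wr f v) = wr ((push ^^ k) f) ((\<alpha> ^^ k) v)"
  by (simp add: act_def)

lemma alpha_pow_add: "(\<alpha> ^^ k) (x + y) = (\<alpha> ^^ k) x + (\<alpha> ^^ k) y"
  by (induction k) (simp_all add: add)

lemma push_pow_eq: "(push ^^ k) f ((\<alpha> ^^ k) x) = f x"
proof (induction k arbitrary: f x)
  case (Suc k)
  have "(push ^^ Suc k) f ((\<alpha> ^^ Suc k) x) = push ((push ^^ k) f) (\<alpha> ((\<alpha> ^^ k) x))"
    by simp
  then show ?case using Suc by (simp add: push_def)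
qed simp

lemma push_pow_period: "push ^^ m = id"
  using push_pow_eq[of m] period by (auto simp: fun_eq_iff)

lemma push_pow_mult:
  "(push ^^ k) (f + shift v g) = (push ^^ k) f + shift ((\<alpha> ^^ k) v) ((push ^^ k) g)"
proof (induction k)
  case (Suc k)
  then show ?case by (simp only: funpow.simps comp_apply push_add push_shift)
qed simp

lemma act_add: "act (k + l) g = act k (act l g)"
  by (simp add: act_def funpow_add)

lemma act_mod:
  assumes "g \<in> carrier (wreath TYPE('v))"
  shows "act (k mod m) g = act k g"
proof -
  have "act (j * m) g = g" for j
    using assms by (induction j) (auto simp: act_add funpow_add push_pow_period period)
  then have "act (k mod m + k div m * m) g = act (k mod m) g" by (simp only: act_add)
  then show ?thesis by (simp only: mod_div_mult_eq)
qed

lemma act_closed: "g \<in> carrier (wreath TYPE('v)) \<Longrightarrow> act k g \<in> carrier (wreath TYPE('v))"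
  by auto

lemma act_inverse:
  assumes "k < m" "g \<in> carrier (wreath TYPE('v))"
  shows "act (m - k) (act k g) = g" "act k (act (m - k) g) = g"
  using assms act_mod[of g m] by (simp_all flip: act_add) (auto simp: act_def)

lemma act_auto:
  assumes "k < m"
  shows "restrict (act k) (carrier (wreath TYPE('v))) \<in> auto (wreath TYPE('v))"
proof -
  let ?G = "wreath TYPE('v)"
  have "restrict (act k) (carrier ?G) \<in> hom ?G ?G"
    by (rule homI) (auto simp: push_pow_mult alpha_pow_add)
  moreover have "bij_betw (act k) (carrier ?G) (carrier ?G)"
    using act_inverse[OF assms] act_closed by (intro bij_betwI[of _ _ _ "act (m - k)"]) auto
  ultimately show ?thesis by (auto simp: auto_def Bij_def)
qed

lemma action_hom: "action \<in> hom (integer_mod_group m) (AutoGroup (wreath TYPE('v)))"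
proof (rule homI)
  have m: "0 < m" using m_gt_1 by simp
  fix a b assume ab: "a \<in> carrier (integer_mod_group m)" "b \<in> carrier (integer_mod_group m)"
  then have ab': "0 \<le> a" "0 \<le> b" "a < int m" "b < int m"
    using m by (auto simp: carrier_integer_mod_group)
  then have lt: "nat a < m" "nat b < m" by auto
  show "action a \<in> carrier (AutoGroup (wreath TYPE('v)))"
    using act_auto[OF lt(1)] by (simp add: AutoGroup_def action_def)
  have "nat ((a + b) mod int m) = (nat a + nat b) mod m"
    using ab' by (simp add: nat_add_distrib nat_mod_distrib)
  then have "action (a \<otimes>\<^bsub>integer_mod_group m\<^esub> b) = compose (carrier (wreath TYPE('v))) (action a) (action b)"
    using act_closed by (auto simp: action_def fun_eq_iff compose_def act_mod act_add restrict_def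
        simp del: wreath_simps)
  then show "action (a \<otimes>\<^bsub>integer_mod_group m\<^esub> b) =
    action a \<otimes>\<^bsub>AutoGroup (wreath TYPE('v))\<^esub> action b"
    using act_auto[OF lt(1)] act_auto[OF lt(2)]
    by (simp add: AutoGroup_def BijGroup_def action_def auto_def)
qed

lemma inj_action: "inj_on action (carrier (integer_mod_group m))"
proof (rule inj_onI)
  have m: "0 < m" using m_gt_1 by simp
  have key: "a = b" if "action (int a) = action (int b)" "a \<le> b" "b < m" for a b
  proof -
    have "(\<alpha> ^^ a) v = (\<alpha> ^^ b) v" for v
      using fun_cong[OF that(1), of "wr 0 v"] by (auto simp: action_def)
    then have "(\<alpha> ^^ a) v = (\<alpha> ^^ (a + (b - a))) v" for v using that by simp
    then have "(\<alpha> ^^ a) v = (\<alpha> ^^ a) ((\<alpha> ^^ (b - a)) v)" for v by (simp only: funpow_add comp_apply)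
    moreover have "inj (\<alpha> ^^ a)" using bij_alpha by (simp add: bij_is_inj inj_fn)
    ultimately have "\<alpha> ^^ (b - a) = id" by (metis id_apply injD ext)
    then show ?thesis using faithful[of "b - a"] that by (simp add: less_imp_diff_less)
  qed
  fix a b assume ab: "a \<in> carrier (integer_mod_group m)" "b \<in> carrier (integer_mod_group m)"
    and eq: "action a = action b"
  then have "0 \<le> a" "0 \<le> b" "a < int m" "b < int m"
    using m by (auto simp: carrier_integer_mod_group)
  then have a: "a = int (nat a)" "nat a < m" and b: "b = int (nat b)" "nat b < m" by auto
  show "a = b"
  proof (cases "nat a \<le> nat b")
    case True
    then show ?thesis using key[OF _ True b(2)] eq a b by metis
  next
    case False
    then have le: "nat b \<le> nat a" by simp
    show ?thesis using key[OF _ le a(2)] eq a b by metis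
  qed
qed

lemma faithful_action: "faithful_action (integer_mod_group m) (carrier (wreath TYPE('v))) action"
proof -
  interpret G: group "wreath TYPE('v)" by (rule group_wreath)
  have "action \<in> hom (integer_mod_group m) (BijGroup (carrier (wreath TYPE('v))))"
    using action_hom subgroup.subset[OF G.subgroup_auto]
    by (auto simp: hom_def AutoGroup_def BijGroup_def)
  then show ?thesis
    by (intro faithful_action.intro group_action.intro group_hom.intro group_hom_axioms.intro
        faithful_action_axioms.intro group_BijGroup inj_action group_integer_mod_group)
qed

lemma coprime_action:
  assumes "coprime m (2 ^ card (UNIV :: 'v set) * card (UNIV :: 'v set))"
  shows "coprime_action (integer_mod_group m) (wreath TYPE('v)) action"
proof (intro coprime_action.intro coprime_action_axioms.intro group_wreath group_integer_mod_group action_hom)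
  have m: "0 < m" using m_gt_1 by simp
  then show "finite (carrier (integer_mod_group m))" by (simp add: carrier_integer_mod_group)
  show "coprime (Coset.order (integer_mod_group m)) (Coset.order (wreath TYPE('v)))"
    using m assms by (simp add: order_wreath Coset.order_def[of "integer_mod_group m"] carrier_integer_mod_group)
  have "0 < Coset.order (wreath TYPE('v))" by (simp add: order_wreath card_gt_0_iff)
  then show "finite (carrier (wreath TYPE('v)))"
    unfolding Coset.order_def by (rule card_ge_0_finite)
qed

lemma action_wr:
  "action a (wr f v) = wr ((push ^^ nat a) f) ((\<alpha> ^^ nat a) v)"
  by (auto simp: action_def)

text \<open>The component in \<open>V\<close> of a fixed element is fixed by \<open>\<alpha>\<close>, hence zero.\<close>

lemma carrier_fixed_group:
  "carrier (fixed_group (integer_mod_group m) (wreath TYPE('v)) action) = {wr f 0 | f. push f = f}"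
proof -
  have one: "1 \<in> carrier (integer_mod_group m)" using m_gt_1 by simp
  have "wr f v = wr f 0 \<and> push f = f" if "\<forall>a\<in>carrier (integer_mod_group m). action a (wr f v) = wr f v" for f v
    using bspec[OF that one] fpf by (simp add: action_wr)
  moreover have "action a (wr f 0) = wr f 0" if "push f = f" for a f
  proof -
    have "(push ^^ k) f = f" "(\<alpha> ^^ k) 0 = 0" for k using that by (induction k) auto
    then show ?thesis by (simp add: action_wr)
  qed
  ultimately show ?thesis
    by (simp add: fixed_group_def) blast
qed

lemma Irr_inv_eq:
  "Irr_inv (integer_mod_group m) (wreath TYPE('v)) action = orbit_character ` {S. push S = S}"
proof -
  have one: "1 \<in> carrier (integer_mod_group m)" using m_gt_1 by simp
  have "(\<forall>a\<in>carrier (integer_mod_group m). \<forall>g\<in>carrier (wreath TYPE('v)). \<chi> (action a g) = \<chi> g) \<longleftrightarrow>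
    (\<forall>f v. \<chi> (wr (push f) (\<alpha> v)) = \<chi> (wr f v))" (is "?L \<longleftrightarrow> ?R") for \<chi> :: "nat \<Rightarrow> complex"
  proof
    assume L: ?L
    show ?R
    proof (intro allI)
      fix f and v :: 'v
      have "wr f v \<in> carrier (wreath TYPE('v))" by auto
      then have "\<chi> (action 1 (wr f v)) = \<chi> (wr f v)" using L one by blast
      then show "\<chi> (wr (push f) (\<alpha> v)) = \<chi> (wr f v)" by (simp add: action_wr)
    qed
  next
    assume R: ?R
    have "\<chi> (wr ((push ^^ k) f) ((\<alpha> ^^ k) v)) = \<chi> (wr f v)" for k f v
      by (induction k) (simp_all add: R)
    then show ?L by (auto simp: action_wr)
  qed
  then show ?thesis
    unfolding Irr_inv_def invariant_irreducible_characters[symmetric] by simp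
qed

lemma card_Irr_inv_nonvanishing:
  "card (Irr_inv_nonvanishing (integer_mod_group m) (wreath TYPE('v)) action) =
    card {S. push S = S \<and> (\<forall>T. push T = T \<longrightarrow> (\<Sum>v\<in>UNIV. bsign (pairing T (shift v S))) \<noteq> 0)}"
proof -
  have "Irr_inv_nonvanishing (integer_mod_group m) (wreath TYPE('v)) action =
    orbit_character ` {S. push S = S \<and> (\<forall>T. push T = T \<longrightarrow> (\<Sum>v\<in>UNIV. bsign (pairing T (shift v S))) \<noteq> 0)}"
    unfolding Irr_inv_nonvanishing_def Irr_inv_eq carrier_fixed_group
    by (auto simp flip: orbit_character_base_eq_0_iff)
  moreover have "inj_on orbit_character
    {S. push S = S \<and> (\<forall>T. push T = T \<longrightarrow> (\<Sum>v\<in>UNIV. bsign (pairing T (shift v S))) \<noteq> 0)}"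
    by (rule inj_on_subset[OF inj_orbit_character]) auto
  ultimately show ?thesis by (simp add: card_image)
qed

text \<open>The fixed points lie in the base group, so they form an abelian group.\<close>

lemma order_abelianization_fixed_group:
  "Coset.order (abelianization (fixed_group (integer_mod_group m) (wreath TYPE('v)) action)) =
    card {S. push S = S}"
proof -
  let ?G = "wreath TYPE('v)"
  let ?C = "fixed_group (integer_mod_group m) ?G action"
  interpret G: group ?G by (rule group_wreath)
  have carrier: "carrier ?C = {wr f 0 | f. push f = f}" by (rule carrier_fixed_group)
  have mult: "wr f 0 \<otimes>\<^bsub>?C\<^esub> wr g (0 :: 'v) = wr (f + g) 0" and one: "\<one>\<^bsub>?C\<^esub> = wr 0 (0 :: 'v)" for f g
    by (simp_all add: fixed_group_def)
  interpret C: comm_group ?C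
  proof (rule comm_groupI)
    fix x assume "x \<in> carrier ?C"
    then show "\<exists>y\<in>carrier ?C. y \<otimes>\<^bsub>?C\<^esub> x = \<one>\<^bsub>?C\<^esub>"
      by (auto simp: carrier mult one add_self)
  qed (auto simp: carrier mult one push_add add_ac)
  have "derived ?C (carrier ?C) \<subseteq> {\<one>\<^bsub>?C\<^esub>}"
  proof -
    have "h1 \<otimes>\<^bsub>?C\<^esub> h2 \<otimes>\<^bsub>?C\<^esub> inv\<^bsub>?C\<^esub> h1 \<otimes>\<^bsub>?C\<^esub> inv\<^bsub>?C\<^esub> h2 = \<one>\<^bsub>?C\<^esub>"
      if "h1 \<in> carrier ?C" "h2 \<in> carrier ?C" for h1 h2
      using that by (metis C.m_comm C.inv_mult_group C.r_inv C.m_assoc C.m_closed C.inv_closed)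
    then show ?thesis
      unfolding derived_def by (intro C.generate_subgroup_incl C.triv_subgroup) auto
  qed
  moreover have "subgroup (derived ?C (carrier ?C)) ?C" by (rule C.derived_is_subgroup) simp
  ultimately have der: "derived ?C (carrier ?C) = {\<one>\<^bsub>?C\<^esub>}"
    using subgroup.one_closed by fastforce
  have "card (rcosets\<^bsub>?C\<^esub> {\<one>\<^bsub>?C\<^esub>}) * card {\<one>\<^bsub>?C\<^esub>} = Coset.order ?C"
    by (rule C.lagrange[OF C.triv_subgroup])
  moreover have "carrier ?C = (\<lambda>f. wr f 0) ` {S. push S = S}" by (auto simp: carrier)
  moreover have "inj_on (\<lambda>f. wr f (0 :: 'v)) {S. push S = S}" by (auto intro: inj_onI)
  ultimately show ?thesis
    unfolding abelianization_def der by (simp add: FactGroup_def Coset.order_def card_image)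
qed

end

section \<open>A fixed-point-free automorphism of order 21\<close>

declare card_UNIV_bit [simp]

type_synonym F4 = "bit \<times> bit"
type_synonym F8 = "bit \<times> bit \<times> bit"
type_synonym V = "(F4 \<times> F4) \<times> F8"

lemma all_bit: "(\<forall>x :: bit. P x) \<longleftrightarrow> P 0 \<and> P 1"
  by (metis bit.exhaust)

lemma sum_UNIV_bit: "(\<Sum>x\<in>UNIV. f (x :: bit)) = f 0 + f 1"
proof -
  have "(UNIV :: bit set) = {0, 1}" by (auto intro: bit.exhaust)
  then have "(\<Sum>x\<in>UNIV. f x) = (\<Sum>x\<in>{0, 1}. f x)" by metis
  then show ?thesis by simp
qed

lemma sum_UNIV_prod: "(\<Sum>x\<in>UNIV. f x) = (\<Sum>a\<in>UNIV. \<Sum>b\<in>UNIV. f (a, b))"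
  by (simp add: sum.cartesian_product)

lemma sum_UNIV_option:
  "(\<Sum>x\<in>UNIV. f (x :: 'a :: finite option)) = f None + (\<Sum>x\<in>UNIV. f (Some x))"
  by (simp add: UNIV_option_conv sum.reindex)

lemma bit_mult_idem: "x * x = (x :: bit)" "x * (x * y) = x * (y :: bit)"
  by (cases x; simp)+

lemma add_self_left: "x + (x + y) = (y :: bit)"
  by (rule add_cancel_twice)

text \<open>Multiplication by a primitive cube root of unity of \<open>F\<^sub>4\<close>, in coordinates with respect to the
  basis \<open>1, \<omega>\<close>.\<close>

definition \<omega> :: "F4 \<Rightarrow> F4" where
  "\<omega> = (\<lambda>(a, b). (b, a + b))"

text \<open>Multiplication by a root of \<open>x\<^sup>3 + x + 1\<close>, which has order 7 in \<open>F\<^sub>8\<close>, in coordinates with respect to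
  the basis \<open>1, \<zeta>\<^sup>2, \<zeta>\<close>.\<close>

definition \<zeta> :: "F8 \<Rightarrow> F8" where
  "\<zeta> = (\<lambda>(a, b, c). (b, c, a + b))"

definition \<alpha> :: "V \<Rightarrow> V" where
  "\<alpha> = (\<lambda>((x, y), z). ((\<omega> x, \<omega> y), \<zeta> z))"

lemma alpha_pow: "(\<alpha> ^^ k) ((x, y), z) = (((\<omega> ^^ k) x, (\<omega> ^^ k) y), (\<zeta> ^^ k) z)"
  by (induction k) (simp_all add: \<alpha>_def)

lemma omega_cube: "(\<omega> ^^ 3) x = x"
  by (cases x) (simp add: \<omega>_def eval_nat_numeral add.commute add_self_left)

lemma zeta_seventh: "(\<zeta> ^^ 7) z = z"
  by (cases z) (simp add: \<zeta>_def eval_nat_numeral add_ac add_self_left add_self)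

lemma omega_pow_mod: "(\<omega> ^^ k) x = (\<omega> ^^ (k mod 3)) x"
  using funpow_mod_eq[OF omega_cube] by metis

lemma zeta_pow_mod: "(\<zeta> ^^ k) z = (\<zeta> ^^ (k mod 7)) z"
  using funpow_mod_eq[OF zeta_seventh] by metis

lemma alpha_21: "\<alpha> ^^ 21 = id"
proof
  fix v show "(\<alpha> ^^ 21) v = id v"
    using omega_pow_mod[of 21] zeta_pow_mod[of 21] by (cases v) (auto simp: alpha_pow)
qed

lemma omega_regular:
  assumes "(\<omega> ^^ r) (1, 0) = (1, 0)" "r < 3"
  shows "r = 0"
proof -
  have "r = 0 \<or> r = 1 \<or> r = 2" using assms by linarith
  then show ?thesis using assms(1) by (elim disjE) (simp_all add: \<omega>_def eval_nat_numeral)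
qed

lemma zeta_regular:
  assumes "(\<zeta> ^^ r) (1, 0, 0) = (1, 0, 0)" "r < 7"
  shows "r = 0"
proof -
  have "r = 0 \<or> r = 1 \<or> r = 2 \<or> r = 3 \<or> r = 4 \<or> r = 5 \<or> r = 6" using assms by linarith
  then show ?thesis using assms(1) by (elim disjE) (simp_all add: \<zeta>_def eval_nat_numeral add_self)
qed

lemma alpha_faithful:
  assumes "k < 21" "\<alpha> ^^ k = id"
  shows "k = 0"
proof -
  have "(\<alpha> ^^ k) (((1, 0), 0), (1, 0, 0)) = (((1, 0), 0), (1, 0, 0))" using assms by simp
  then have om: "(\<omega> ^^ (k mod 3)) (1, 0) = (1, 0)" and ze: "(\<zeta> ^^ (k mod 7)) (1, 0, 0) = (1, 0, 0)"
    using omega_pow_mod[of k] zeta_pow_mod[of k] by (simp_all add: alpha_pow)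
  have "k mod 3 = 0" using om by (rule omega_regular) simp
  moreover have "k mod 7 = 0" using ze by (rule zeta_regular) simp
  ultimately show ?thesis using assms(1) by presburger
qed

lemma omega_fpf: "\<omega> x = x \<Longrightarrow> x = 0"
  by (cases x) (auto simp: \<omega>_def zero_prod_def add_self)

lemma zeta_fpf: "\<zeta> z = z \<Longrightarrow> z = 0"
  by (cases z) (auto simp: \<zeta>_def zero_prod_def add_self)

lemma fpf_automorphism_alpha: "fpf_automorphism \<alpha> 21"
proof
  show "\<alpha> (x + y) = \<alpha> x + \<alpha> y" for x y
    by (auto simp: \<alpha>_def \<omega>_def \<zeta>_def add_ac split: prod.splits)
  show "x = 0" if "\<alpha> x = x" for x
    using that omega_fpf zeta_fpf by (auto simp: \<alpha>_def zero_prod_def split: prod.splits)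
qed (use alpha_21 alpha_faithful in simp_all)

interpretation fpf_automorphism \<alpha> 21
  by (rule fpf_automorphism_alpha)

section \<open>The invariant elements of the group algebra\<close>

type_synonym slope = "F4 option"

text \<open>The lines through the origin of \<open>F\<^sub>4\<^sup>2\<close> are indexed by the projective line over \<open>F\<^sub>4\<close>, where \<open>None\<close> is
  the point at infinity. The slope is \<open>y / x\<close>, and division by \<open>\<omega>\<close> is multiplication by \<open>\<omega>\<^sup>2\<close>. The
  value at the zero vector is a default.\<close>

definition slope :: "F4 \<times> F4 \<Rightarrow> slope" where
  "slope = (\<lambda>(x, y).
    if x = (0, 0) then None
    else if x = (1, 0) then Some y
    else if x = (0, 1) then Some (\<omega> (\<omega> y))
    else Some (\<omega> y))"

definition line_point :: "slope \<Rightarrow> F4 \<times> F4" where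
  "line_point i = (case i of None \<Rightarrow> (0, (1, 0)) | Some y \<Rightarrow> ((1, 0), y))"

definition parity :: "('i :: finite \<Rightarrow> bit) \<Rightarrow> bit" where
  "parity b = (\<Sum>i\<in>UNIV. b i)"

text \<open>The element \<open>a + \<Sum>\<^sub>i b\<^sub>i l\<^sub>i\<close> of the group algebra of \<open>F\<^sub>4\<^sup>2\<close> over the field with two elements, where \<open>l\<^sub>i\<close> is
  the sum of the four vectors on the line with slope \<open>i\<close>. All lines contain the zero vector, which
  accounts for the parity.\<close>

definition line_fun :: "bit \<Rightarrow> (slope \<Rightarrow> bit) \<Rightarrow> F4 \<times> F4 \<Rightarrow> bit" where
  "line_fun a b u = (if u = 0 then a + parity b else b (slope u))"

lemma all_F4_F4: "(\<forall>u :: F4 \<times> F4. P u) \<longleftrightarrow>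
  (\<forall>x1 x2 y1 y2. P ((x1, x2), (y1, y2)))"
  by auto

text \<open>Multiplication in the group algebra: \<open>l\<^sub>i l\<^sub>i = 4 l\<^sub>i = 0\<close>, and for \<open>i \<noteq> j\<close> the product \<open>l\<^sub>i l\<^sub>j\<close> is the
  sum of all 16 vectors, because each of them is uniquely a sum of vectors on the two lines. That
  sum equals the sum of all five \<open>l\<^sub>k\<close>, in which the zero vector occurs five times.\<close>

lemma sum_line_fun_mult:
  "(\<Sum>w\<in>UNIV. line_fun a b w * line_fun a' b' (w + u)) =
    line_fun (a * a') (\<lambda>i. a * b' i + a' * b i + (parity b * parity b' + pairing b b')) u"
proof -
  have "\<forall>u. (\<Sum>w\<in>UNIV. line_fun a b w * line_fun a' b' (w + u)) =
    line_fun (a * a') (\<lambda>i. a * b' i + a' * b i + (parity b * parity b' + pairing b b')) u"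
    unfolding all_F4_F4 all_bit
    \<comment> \<open>one identity for each of the 16 vectors \<open>u\<close>: both sides become polynomials in the
      coefficients, and equal monomials cancel in pairs\<close>
    apply (intro conjI)
    apply (simp_all add: line_fun_def slope_def \<omega>_def parity_def pairing_def sum_UNIV_bit sum_UNIV_prod sum_UNIV_option
      zero_prod_def add_self)
    apply (simp_all add: algebra_simps add_self add_self_left)
    done
  then show ?thesis by (rule spec)
qed

lemma sum_line_funs:
  fixes F :: "bit \<Rightarrow> bit \<Rightarrow> 'a :: comm_semiring_1"
  shows "(\<Sum>u\<in>UNIV. F (line_fun a b u) (line_fun c d u)) =
    F (a + parity b) (c + parity d) + 3 * (\<Sum>i\<in>UNIV. F (b i) (d i))"
proof -
  \<comment> \<open>each line has three nonzero vectors\<close>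
  have "(\<Sum>i\<in>UNIV. F (b i) (d i)) = F (b None) (d None) + F (b (Some (0, 0))) (d (Some (0, 0))) +
      F (b (Some (0, 1))) (d (Some (0, 1))) + F (b (Some (1, 0))) (d (Some (1, 0))) + F (b (Some (1, 1))) (d (Some (1, 1)))"
    by (simp add: sum_UNIV_bit sum_UNIV_prod sum_UNIV_option add_ac)
  moreover have "3 * x = x + x + x" for x :: 'a
  proof -
    have "(3 :: 'a) = 1 + 1 + 1" by simp
    then show ?thesis by (simp only: distrib_right mult_1_left)
  qed
  ultimately show ?thesis
    by (simp add: line_fun_def slope_def \<omega>_def sum_UNIV_bit sum_UNIV_prod zero_prod_def add_self add_ac)
qed

lemma line_fun_line_point: "line_fun a b (line_point i) = b i"
  by (cases i) (auto simp: line_fun_def line_point_def slope_def zero_prod_def)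

text \<open>The three nonzero vectors of a line are permuted transitively by multiplication by \<open>\<omega>\<close>.\<close>

lemma omega_invariant_imp_line_fun:
  fixes f :: "F4 \<times> F4 \<Rightarrow> bit"
  assumes inv: "\<And>x y. f (\<omega> x, \<omega> y) = f (x, y)"
  shows "f = line_fun (f 0 + parity (\<lambda>i. f (line_point i))) (\<lambda>i. f (line_point i))"
proof
  fix u
  show "f u = line_fun (f 0 + parity (\<lambda>i. f (line_point i))) (\<lambda>i. f (line_point i)) u"
  proof (cases "u = 0")
    case True
    then show ?thesis by (simp add: line_fun_def add_self add.assoc)
  next
    case False
    have "\<forall>u. u \<noteq> 0 \<longrightarrow> line_point (slope u) = u \<or> line_point (slope u) = map_prod \<omega> \<omega> u \<or>
        line_point (slope u) = map_prod \<omega> \<omega> (map_prod \<omega> \<omega> u)"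
      unfolding all_F4_F4 all_bit
      by (simp add: slope_def line_point_def \<omega>_def zero_prod_def add_self)
    moreover have "f (map_prod \<omega> \<omega> w) = f w" for w by (cases w) (simp add: inv)
    ultimately have "f (line_point (slope u)) = f u" using False by metis
    then show ?thesis using False by (simp add: line_fun_def)
  qed
qed

lemma line_fun_omega: "line_fun a b (\<omega> x, \<omega> y) = line_fun a b (x, y)"
proof -
  have "\<forall>u. line_fun a b (map_prod \<omega> \<omega> u) = line_fun a b u"
    unfolding all_F4_F4 all_bit
    by (simp add: line_fun_def slope_def \<omega>_def zero_prod_def add_self)
  from spec[OF this, of "(x, y)"] show ?thesis by simp
qed

type_synonym coords = "bit \<times> (slope \<Rightarrow> bit) \<times> bit \<times> (slope \<Rightarrow> bit)"

text \<open>The element \<open>p + q s\<close> of the group algebra of \<open>V\<close>, where \<open>p = a + \<Sum>\<^sub>i b\<^sub>i l\<^sub>i\<close>, \<open>q = c + \<Sum>\<^sub>i d\<^sub>i l\<^sub>i\<close> and \<open>s\<close> is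
  the sum of the elements of \<open>F\<^sub>8\<close>.\<close>

definition invariant_fun :: "coords \<Rightarrow> V \<Rightarrow> bit" where
  "invariant_fun = (\<lambda>(a, b, c, d) (u, z). line_fun c d u + (if z = 0 then line_fun a b u else 0))"

lemma zeta_zero_iff: "\<zeta> z = 0 \<longleftrightarrow> z = 0"
  by (cases z) (auto simp: \<zeta>_def zero_prod_def add_self)

lemma push_invariant_fun: "push (invariant_fun h) = invariant_fun h"
  unfolding push_fixed_iff
  by (auto simp: invariant_fun_def \<alpha>_def line_fun_omega zeta_zero_iff split: prod.splits)

lemma zeta_transitive:
  assumes "z \<noteq> 0"
  obtains k where "z = (\<zeta> ^^ k) (1, 0, 0)"
proof -
  have "\<forall>a b c. (a, b, c) \<noteq> (0 :: F8) \<longrightarrow> (\<exists>k\<in>{0, 1, 2, 3, 4, 5, 6}. (a, b, c) = (\<zeta> ^^ k) (1, 0, 0))"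
    unfolding all_bit
    by (simp add: \<zeta>_def zero_prod_def eval_nat_numeral add_self)
  then show ?thesis using that assms by (metis prod_cases3)
qed

text \<open>An invariant function is invariant under \<open>\<omega>\<close> and under \<open>\<zeta>\<close> separately, because the orders of
  these two automorphisms are coprime.\<close>

lemma push_fixed_imp_invariant_fun:
  assumes S: "push S = S"
  shows "S \<in> range invariant_fun"
proof -
  have "S (\<alpha> v) = S v" for v using S unfolding push_fixed_iff by blast
  then have pow: "S ((\<alpha> ^^ k) v) = S v" for k v by (induction k) simp_all
  \<comment> \<open>7 is 1 modulo 3 and 0 modulo 7, while 15 is 0 modulo 3 and 1 modulo 7: the corresponding
    powers of \<open>\<alpha>\<close> act on one factor only\<close>
  have om: "S ((\<omega> x, \<omega> y), z) = S ((x, y), z)" for x y z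
    using pow[of 7 "((x, y), z)"] omega_pow_mod[of 7] by (simp add: alpha_pow zeta_seventh)
  have ze: "S (u, \<zeta> z) = S (u, z)" for u z
    using pow[of 15 "(u, z)"] omega_pow_mod[of 15] zeta_pow_mod[of 15] by (cases u) (simp add: alpha_pow)
  define p q where "p u = S (u, 0) + S (u, (1, 0, 0))" and "q u = S (u, (1, 0, 0))" for u
  have ze_pow: "S (u, (\<zeta> ^^ k) z) = S (u, z)" for u k z by (induction k) (simp_all add: ze)
  have "S (u, z) = q u + (if z = 0 then p u else 0)" for u z
  proof (cases "z = 0")
    case False
    then obtain k where "z = (\<zeta> ^^ k) (1, 0, 0)" by (rule zeta_transitive)
    then show ?thesis using False ze_pow by (simp add: q_def)
  qed (simp add: p_def q_def add.commute add_self_left)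
  moreover obtain a b where "p = line_fun a b"
    using omega_invariant_imp_line_fun[of p] om by (auto simp: p_def)
  moreover obtain c d where "q = line_fun c d"
    using omega_invariant_imp_line_fun[of q] om by (auto simp: q_def)
  ultimately have "S = invariant_fun (a, b, c, d)"
    by (auto simp: invariant_fun_def)
  then show ?thesis by simp
qed

lemma push_fixed_eq_range: "{S. push S = S} = range invariant_fun"
  using push_invariant_fun push_fixed_imp_invariant_fun by auto

lemma inj_invariant_fun: "inj invariant_fun"
proof (rule injI)
  fix h h' assume eq: "invariant_fun h = invariant_fun h'"
  obtain a b c d a' b' c' d' where h: "h = (a, b, c, d)" "h' = (a', b', c', d')" by (cases h, cases h') auto
  have q: "line_fun c d u = line_fun c' d' u" for u
    using fun_cong[OF eq, of "(u, (1, 0, 0))"] by (simp add: h invariant_fun_def zero_prod_def)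
  have p: "line_fun a b u = line_fun a' b' u" for u
    using fun_cong[OF eq, of "(u, 0)"] q[of u] by (simp add: h invariant_fun_def)
  have "b = b'" "d = d'" using p q by (metis ext line_fun_line_point)+
  moreover have "a + parity b = a' + parity b'" "c + parity d = c' + parity d'"
    using p[of 0] q[of 0] by (simp_all add: line_fun_def)
  ultimately show "h = h'" by (simp add: h)
qed

text \<open>The product of invariant elements of the group algebra in coordinates, where \<open>s s = 8 s = 0\<close>.\<close>

definition ring_mult ::
  "coords \<Rightarrow> coords \<Rightarrow>
    coords" where
  "ring_mult = (\<lambda>(a, b, c, d) (a', b', c', d').
    (a * a', \<lambda>i. a * b' i + a' * b i + (parity b * parity b' + pairing b b'),
     a * c' + c * a',
     \<lambda>i. a * d' i + c' * b i + (parity b * parity d' + pairing b d') +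
        (c * b' i + a' * d i + (parity d * parity b' + pairing d b'))))"

lemma line_fun_add: "line_fun a b u + line_fun a' b' u = line_fun (a + a') (\<lambda>i. b i + b' i) u"
  by (simp add: line_fun_def parity_def sum.distrib add_ac)

lemma sum_F8_const: "(\<Sum>z\<in>(UNIV :: F8 set). x :: bit) = 0"
  by (simp add: sum_UNIV_prod sum_UNIV_bit add_self)

text \<open>Since \<open>- v = v\<close> in \<open>V\<close>, pairing with the translates of a function is convolution, which is the
  multiplication of the group algebra.\<close>

lemma pairing_shift_invariant_fun:
  "pairing (invariant_fun h') (shift v (invariant_fun h)) = invariant_fun (ring_mult h h') v"
proof -
  obtain a b c d a' b' c' d' where h: "h = (a, b, c, d)" "h' = (a', b', c', d')" by (cases h, cases h') auto
  obtain u z where v: "v = (u, z)" by (cases v)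
  let ?p = "line_fun a b" and ?q = "line_fun c d" and ?p' = "line_fun a' b'" and ?q' = "line_fun c' d'"
  have zz: "y + z = 0 \<longleftrightarrow> y = z" for y :: F8
    by (metis add_self add_cancel_twice(2) add.left_neutral)
  have inner: "(\<Sum>y\<in>UNIV. invariant_fun h' (w, y) * invariant_fun h (w + u, y + z)) =
    ?p (w + u) * ?q' w + ?q (w + u) * ?p' w + (if z = 0 then ?p (w + u) * ?p' w else 0)" for w
  proof -
    have "(\<Sum>y\<in>UNIV. invariant_fun h' (w, y) * invariant_fun h (w + u, y + z)) =
      (\<Sum>y\<in>UNIV. ?q' w * ?q (w + u) + (if y = z then ?q' w * ?p (w + u) else 0) +
        (if y = 0 then ?p' w * ?q (w + u) + (if z = 0 then ?p' w * ?p (w + u) else 0) else 0))"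
      by (intro sum.cong) (auto simp: h invariant_fun_def zz algebra_simps)
    also have "\<dots> = ?q' w * ?p (w + u) + (?p' w * ?q (w + u) + (if z = 0 then ?p' w * ?p (w + u) else 0))"
      by (simp add: sum.distrib sum_F8_const)
    finally show ?thesis by (simp add: mult.commute add.assoc)
  qed
  have conv: "(\<Sum>w\<in>UNIV. line_fun k l (w + u) * line_fun k' l' w) =
    line_fun (k * k') (\<lambda>i. k * l' i + k' * l i + (parity l * parity l' + pairing l l')) u" for k l k' l'
    using sum_line_fun_mult[of k' l' k l u] by (simp add: mult.commute add.commute pairing_commute)
  have "pairing (invariant_fun h') (shift v (invariant_fun h)) =
    (\<Sum>x\<in>UNIV. invariant_fun h' x * invariant_fun h (x + (u, z)))"
    by (simp add: pairing_def shift_def v minus_eq_plus)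
  also have "\<dots> =
    (\<Sum>w\<in>UNIV. \<Sum>y\<in>UNIV. invariant_fun h' (w, y) * invariant_fun h (w + u, y + z))"
    by (subst sum_UNIV_prod) simp
  also have "\<dots> = (\<Sum>w\<in>UNIV. ?p (w + u) * ?q' w) + (\<Sum>w\<in>UNIV. ?q (w + u) * ?p' w) +
      (if z = 0 then \<Sum>w\<in>UNIV. ?p (w + u) * ?p' w else 0)"
    by (simp add: inner sum.distrib)
  also have "\<dots> = invariant_fun (ring_mult h h') v"
    by (simp add: conv line_fun_add invariant_fun_def ring_mult_def h v)
  finally show ?thesis .
qed

section \<open>Balanced elements and their divisors\<close>

definition weight :: "('i :: finite \<Rightarrow> bit) \<Rightarrow> nat" where
  "weight b = card {i. b i = 1}"

text \<open>With \<open>l\<^sub>I\<close> denoting the sum of the \<open>l\<^sub>i\<close> for \<open>i \<in> I\<close>, these are the elements \<open>l\<^sub>I + s + l\<^sub>J s\<close> where \<open>I\<close> has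
  three elements and \<open>J\<close> is \<open>I\<close> or its complement.\<close>

definition balanced :: "coords \<Rightarrow> bool" where
  "balanced = (\<lambda>(a, b, c, d). a = 0 \<and> c = 1 \<and> weight b = 3 \<and> (d = b \<or> d = b + 1))"

lemma card_slope: "card (UNIV :: slope set) = 5"
  by (simp add: card_UNIV_bit)

lemma sum_bsign: "(\<Sum>i\<in>UNIV. bsign (b i)) = of_nat (card (UNIV :: 'i set)) - 2 * of_nat (weight b)"
  for b :: "'i :: finite \<Rightarrow> bit"
proof -
  have "(\<Sum>i\<in>UNIV. bsign (b i)) = (\<Sum>i\<in>UNIV. 1 - 2 * (if b i = 1 then 1 else 0))"
    by (intro sum.cong) (auto simp: bsign_def)
  then show ?thesis
    by (simp add: sum_subtractf sum_distrib_left[symmetric] weight_def sum.If_cases)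
qed

lemma of_nat_bit: "of_nat n = (of_bool (odd n) :: bit)"
proof (induction n)
  case (Suc n)
  then show ?case by (cases "odd n") (simp_all add: add_self)
qed simp

lemma parity_eq_weight: "parity b = of_bool (odd (weight b))"
proof -
  have "parity b = (\<Sum>i\<in>UNIV. of_bool (b i = 1))"
    unfolding parity_def by (intro sum.cong) auto
  also have "\<dots> = of_nat (weight b)" by (simp add: weight_def)
  also have "\<dots> = (of_bool (odd (weight b)) :: bit)"
    by (rule of_nat_bit)
  finally show ?thesis .
qed

lemma weight_complement: "weight (b + 1) + weight b = card (UNIV :: 'i set)" for b :: "'i :: finite \<Rightarrow> bit"
proof -
  have "{i. (b + 1) i = 1} = - {i. b i = 1}"
    by (auto simp: add_self)
  then show ?thesis by (simp add: weight_def Compl_eq_Diff_UNIV card_Diff_subset card_mono)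
qed

lemma weight_eq_0_iff: "weight b = 0 \<longleftrightarrow> b = 0" for b :: "'i :: finite \<Rightarrow> bit"
  by (auto simp: weight_def fun_eq_iff)

lemma weight_le: "weight b \<le> 5" for b :: "slope \<Rightarrow> bit"
  using weight_complement[of b] card_slope by simp

lemma weight_eq_5_iff: "weight b = 5 \<longleftrightarrow> b = 1" for b :: "slope \<Rightarrow> bit"
proof -
  have "weight b = 5 \<longleftrightarrow> weight (b + 1) = 0"
    using weight_complement[of b] card_slope by auto
  also have "\<dots> \<longleftrightarrow> b = 1"
    unfolding weight_eq_0_iff by (metis add_cancel_twice(2) add_self add.left_neutral)
  finally show ?thesis .
qed

text \<open>The signs \<open>s0\<close> and \<open>s1\<close> belong to the orbits of sizes 1 and 7 on \<open>0 \<times> F\<^sub>8\<close>; of the five orbits of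
  size 3 and the five orbits of size 21, \<open>n0\<close> and \<open>n1\<close> carry the sign \<open>-1\<close>.\<close>

lemma balance_equation:
  fixes s0 s1 :: int and n0 n1 :: nat
  assumes s: "s0 = 1 \<or> s0 = - 1" "s1 = 1 \<or> s1 = - 1" and n: "n0 \<le> 5" "n1 \<le> 5"
  shows "s0 + 7 * s1 + 120 - 6 * int n0 - 42 * int n1 = 0 \<longleftrightarrow>
    s0 = - 1 \<and> s1 = 1 \<and> n0 = 0 \<and> n1 = 3 \<or> s0 = 1 \<and> s1 = - 1 \<and> n0 = 5 \<and> n1 = 2"
proof
  assume eq: "s0 + 7 * s1 + 120 - 6 * int n0 - 42 * int n1 = 0"
  have "s0 = - 1 \<and> s1 = 1 \<or> s0 = 1 \<and> s1 = - 1"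
    using s eq by presburger
  then show "s0 = - 1 \<and> s1 = 1 \<and> n0 = 0 \<and> n1 = 3 \<or> s0 = 1 \<and> s1 = - 1 \<and> n0 = 5 \<and> n1 = 2"
  proof (elim disjE conjE)
    assume "s0 = - 1" "s1 = 1"
    moreover from this have "n1 = 3" using eq n by linarith
    ultimately show ?thesis using eq by simp
  next
    assume "s0 = 1" "s1 = - 1"
    moreover from this have "n1 = 2" using eq n by linarith
    ultimately show ?thesis using eq by simp
  qed
qed auto

text \<open>The sum vanishes iff the function has the value 1 at exactly 64 of the 128 points. It is constant
  on the orbits, which have sizes 1 and 7 and, for every line, sizes 3 and 21. A union of orbits
  has 64 points only if it consists of the zero vector and three orbits of size 21, or is the
  complement of such a set; these two kinds of sets are the two kinds of balanced elements.\<close>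

lemma sum_bsign_invariant_fun_eq_0_iff:
  "(\<Sum>v\<in>UNIV. bsign (invariant_fun h v)) = 0 \<longleftrightarrow> balanced h"
proof -
  obtain a b c d where h: "h = (a, b, c, d)" by (cases h)
  define e0 e1 where "e0 = (c + parity d) + (a + parity b)" and "e1 = c + parity d"
  define n0 n1 where "n0 = weight (\<lambda>i. d i + b i)" and "n1 = weight d"
  define isign :: "bit \<Rightarrow> int" where "isign x = (if x = 0 then 1 else - 1)" for x
  have isign: "bsign x = of_int (isign x)" for x by (simp add: isign_def bsign_def)
  have "(\<Sum>v\<in>UNIV. bsign (invariant_fun h v)) =
    (\<Sum>u\<in>UNIV. bsign (line_fun c d u + line_fun a b u) + 7 * bsign (line_fun c d u))"
    unfolding sum_UNIV_prod[of "\<lambda>v. bsign (invariant_fun h v)"]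
    by (intro sum.cong refl)
      (simp add: h invariant_fun_def sum_UNIV_prod sum_UNIV_bit zero_prod_def)
  also have "\<dots> = bsign e0 + 7 * bsign e1 + 3 * (\<Sum>i\<in>UNIV. bsign (d i + b i) + 7 * bsign (d i))"
    using sum_line_funs[of "\<lambda>x y. bsign (y + x) + 7 * bsign y" a b c d] by (simp add: e0_def e1_def)
  also have "\<dots> = bsign e0 + 7 * bsign e1 + 3 * ((5 - 2 * of_nat n0) + 7 * (5 - 2 * of_nat n1))"
    by (simp add: sum.distrib sum_distrib_left[symmetric] sum_bsign card_slope n0_def n1_def)
  also have "\<dots> = of_int (isign e0 + 7 * isign e1 + 120 - 6 * int n0 - 42 * int n1)"
    by (simp add: isign)
  finally have "(\<Sum>v\<in>UNIV. bsign (invariant_fun h v)) = 0 \<longleftrightarrow>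
      isign e0 + 7 * isign e1 + 120 - 6 * int n0 - 42 * int n1 = 0"
    by (simp only: of_int_eq_0_iff)
  also have "\<dots> \<longleftrightarrow> e0 = 1 \<and> e1 = 0 \<and> n0 = 0 \<and> n1 = 3 \<or> e0 = 0 \<and> e1 = 1 \<and> n0 = 5 \<and> n1 = 2"
  proof -
    have "n0 \<le> 5" "n1 \<le> 5" unfolding n0_def n1_def by (rule weight_le)+
    then show ?thesis
      by (subst balance_equation) (auto simp: isign_def split: if_splits)
  qed
  also have "\<dots> \<longleftrightarrow> balanced h"
  proof -
    have n0: "n0 = 0 \<longleftrightarrow> d = b" "n0 = 5 \<longleftrightarrow> d = b + 1"
    proof -
      have "(\<lambda>i. d i + b i) = d + b" by (simp add: fun_eq_iff)
      then have "n0 = 0 \<longleftrightarrow> d + b = 0" "n0 = 5 \<longleftrightarrow> d + b = 1"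
        unfolding n0_def by (simp_all add: weight_eq_0_iff weight_eq_5_iff)
      moreover have "d + b = 0 \<longleftrightarrow> d = b" "d + b = 1 \<longleftrightarrow> d = b + 1"
        by (metis add_cancel_twice(2) add_self add.left_neutral,
            metis add_cancel_twice add.commute)
      ultimately show "n0 = 0 \<longleftrightarrow> d = b" "n0 = 5 \<longleftrightarrow> d = b + 1" by auto
    qed
    have "e0 = 1 \<and> e1 = 0 \<and> d = b \<and> n1 = 3 \<longleftrightarrow> a = 0 \<and> c = 1 \<and> weight b = 3 \<and> d = b"
      by (cases a; cases c) (auto simp: e0_def e1_def n1_def parity_eq_weight)
    moreover have "e0 = 0 \<and> e1 = 1 \<and> d = b + 1 \<and> n1 = 2 \<longleftrightarrow>
      a = 0 \<and> c = 1 \<and> weight b = 3 \<and> d = b + 1"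
    proof -
      have "weight (b + 1) = 2 \<longleftrightarrow> weight b = 3"
        using weight_complement[of b] card_slope by auto
      then show ?thesis
        by (cases a; cases c) (auto simp: e0_def e1_def n1_def parity_eq_weight)
    qed
    ultimately show ?thesis unfolding n0 by (auto simp: balanced_def h)
  qed
  finally show ?thesis .
qed

lemma parity_simps:
  "parity (\<lambda>i. f i + g i) = parity f + parity g"
  "parity (\<lambda>i. x * f i) = x * parity f"
  "parity (\<lambda>i :: slope. x) = x"
  "parity 0 = 0"
proof -
  show "parity (\<lambda>i :: slope. x) = x"
    by (cases x) (simp_all add: parity_def card_slope)
qed (simp_all add: parity_def sum.distrib sum_distrib_left)

lemma pairing_simps_right:
  "pairing b (\<lambda>i. f i + g i) = pairing b f + pairing b g"
  "pairing b (\<lambda>i. x * f i) = x * pairing b f"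
  "pairing b (\<lambda>i. x) = x * parity b"
  "pairing b b = parity b"
proof -
  show "pairing b b = parity b" by (simp add: pairing_def parity_def bit_mult_idem)
qed (simp_all add: pairing_def parity_def sum.distrib sum_distrib_left algebra_simps)

text \<open>Elements with \<open>a = 1\<close> are their own inverses in the ring of invariants. The instance needed is the
  action on balanced elements of the form \<open>l\<^sub>I + s + l\<^sub>I s\<close>.\<close>

lemma ring_mult_involution:
  "ring_mult (1, b, c, d) (ring_mult (1, b, c, d) (0, e, 1, e)) = (0, e, 1, e)"
  by (simp add: ring_mult_def fun_eq_iff parity_simps pairing_simps_right algebra_simps add_self add_self_left
      bit_mult_idem)

text \<open>If \<open>a = 1\<close>, the element is a unit and divides everything. If \<open>a = 0\<close>, the coefficient \<open>c a'\<close> of \<open>s\<close>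
  in a product has to be 1, so \<open>c = a' = 1\<close>. In coordinates the product is \<open>(0, b + X, 1, _)\<close> for a
  constant \<open>X\<close>, so \<open>X = 0\<close> requires \<open>b\<close> to have weight 3 and \<open>X = 1\<close> requires weight 2. The condition on
  the last coordinate determines \<open>b'\<close> up to multiples of \<open>b\<close> and constants, which do not affect \<open>X\<close>;
  evaluating \<open>X\<close> gives the condition on \<open>d\<close>.\<close>

lemma balanced_multiple_iff:
  "(\<exists>h'. balanced (ring_mult (a, b, c, d) h')) \<longleftrightarrow>
    a = 1 \<or> c = 1 \<and> (weight b = 3 \<and> pairing d (b + 1) = 0 \<or> weight b = 2 \<and> pairing d b = 1)"
    (is "?L \<longleftrightarrow> ?R")
proof
  assume ?L
  then obtain a' b' c' d' where bal: "balanced (ring_mult (a, b, c, d) (a', b', c', d'))" by auto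
  show ?R
  proof (cases "a = 0")
    case True
    define X where "X = parity b * parity b' + pairing b b'"
    define Y where "Y = (parity b * parity d' + pairing b d') + (parity d * parity b' + pairing d b')"
    have "c = 1" "a' = 1" using bal True by (cases c; cases a'; simp add: balanced_def ring_mult_def)+
    then have mult: "ring_mult (a, b, c, d) (a', b', c', d') =
      (0, \<lambda>i. b i + X, 1, \<lambda>i. c' * b i + b' i + d i + Y)"
      using True by (simp add: ring_mult_def fun_eq_iff X_def Y_def add_ac)
    have w: "weight (\<lambda>i. b i + X) = 3" using bal by (simp add: mult balanced_def)
    obtain z where z: "\<And>i. c' * b i + b' i + d i + Y = b i + X + z"
      using bal unfolding mult balanced_def
      by (auto simp: fun_eq_iff)
    have b': "b' = (\<lambda>i. d i + b i + c' * b i + (X + Y + z))"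
    proof
      fix i
      have "b' i = (c' * b i + b' i + d i + Y) + (c' * b i + d i + Y)"
        by (simp add: add_ac add_self add_self_left)
      also have "\<dots> = d i + b i + c' * b i + (X + Y + z)"
        unfolding z by (simp add: add_ac)
      finally show "b' i = d i + b i + c' * b i + (X + Y + z)" .
    qed
    show ?R
    proof (cases "X = 0")
      case X: True
      then have "weight b = 3" using w by simp
      moreover have "parity b = 1" using \<open>weight b = 3\<close> by (simp add: parity_eq_weight)
      moreover have "X = parity b * (parity d + parity b + c' * parity b + (X + Y + z)) +
          (pairing b d + parity b + c' * parity b + (X + Y + z) * parity b)"
        by (subst X_def, subst (1 2) b') (simp add: parity_simps pairing_simps_right algebra_simps)
      ultimately have "parity d + pairing b d = 0"
        using X by (simp add: algebra_simps add_self add_self_left)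
      then have "pairing d (b + 1) = 0"
        by (simp add: pairing_add pairing_commute[of d b] add.commute pairing_def[of d 1] parity_def)
      then show ?thesis using \<open>weight b = 3\<close> \<open>c = 1\<close> by simp
    next
      case X: False
      then have "X = 1" by simp
      then have "weight (b + 1) = 3" using w by (simp add: plus_fun_def)
      then have w2: "weight b = 2" using weight_complement[of b] card_slope by simp
      then have "parity b = 0" by (simp add: parity_eq_weight)
      moreover have "X = parity b * (parity d + parity b + c' * parity b + (X + Y + z)) +
          (pairing b d + parity b + c' * parity b + (X + Y + z) * parity b)"
        by (subst X_def, subst (1 2) b') (simp add: parity_simps pairing_simps_right algebra_simps)
      ultimately have "pairing d b = 1" using \<open>X = 1\<close> by (simp add: pairing_commute)
      then show ?thesis using w2 \<open>c = 1\<close> by simp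
    qed
  qed simp
next
  assume R: ?R
  show ?L
  proof (cases "a = 0")
    case False
    define e :: "slope \<Rightarrow> bit" where "e i = (if i \<in> {None, Some (0, 0), Some (0, 1)} then 1 else 0)" for i
    have "{i. e i = 1} = {None, Some (0, 0), Some (0, 1)}" by (auto simp: e_def)
    then have "weight e = 3" by (simp add: weight_def)
    then have "balanced (ring_mult (a, b, c, d) (ring_mult (a, b, c, d) (0, e, 1, e)))"
      using False ring_mult_involution by (simp add: balanced_def)
    then show ?thesis by blast
  next
    case a: True
    then have c: "c = 1" using R by simp
    \<comment> \<open>the simplest \<open>b'\<close> for which the last coordinate becomes \<open>b\<close> up to a constant\<close>
    define b' where "b' = (\<lambda>i. b i + d i)"
    define X where "X = parity b * parity b' + pairing b b'"
    define Y where "Y = parity d * parity b' + pairing d b'"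
    have mult: "ring_mult (a, b, c, d) (1, b', 0, 0) = (0, \<lambda>i. b i + X, 1, \<lambda>i. b i + Y)"
      by (simp add: ring_mult_def a c fun_eq_iff X_def Y_def parity_simps)
        (simp add: b'_def add_ac add_self_left)
    have X: "X = parity b * (parity b + parity d) + (parity b + pairing b d)"
      by (simp add: X_def b'_def parity_simps pairing_simps_right)
    have "balanced (0, \<lambda>i. b i + X, 1, \<lambda>i. b i + Y)"
      using R a
    proof (elim disjE conjE)
      assume w: "weight b = 3" and p: "pairing d (b + 1) = 0"
      have "parity b = 1" using w by (simp add: parity_eq_weight)
      moreover have "pairing b d + parity d = 0"
        using p by (simp add: pairing_add pairing_commute[of d b] pairing_def[of d 1] parity_def)
      ultimately have "X = 0" using X by (simp add: add_ac add_self_left)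
      then show ?thesis using w by (cases Y) (auto simp: balanced_def fun_eq_iff)
    next
      assume w: "weight b = 2" and p: "pairing d b = 1"
      have "parity b = 0" using w by (simp add: parity_eq_weight)
      then have "X = 1" using X p by (simp add: pairing_commute)
      moreover have "weight (b + 1) = 3" using w weight_complement[of b] card_slope by simp
      ultimately show ?thesis by (cases Y) (auto simp: balanced_def fun_eq_iff plus_fun_def add_self add.assoc)
    qed simp
    then show ?thesis unfolding mult[symmetric] by blast
  qed
qed

lemma card_slope_funs: "card (UNIV :: (slope \<Rightarrow> bit) set) = 32"
  by (simp add: card_fun card_UNIV_bit card_slope)

lemma card_pairing_eq:
  fixes e :: "slope \<Rightarrow> bit"
  assumes "e \<noteq> 0"
  shows "card {d. pairing d e = x} = 16"
proof -
  have "of_nat 32 - 2 * of_nat (card {d. pairing d e = 1}) = (0 :: complex)"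
    using sum_bsign[of "\<lambda>d. pairing d e"] assms
    by (simp add: sum_bsign_pairing weight_def card_slope_funs)
  then have "of_nat (2 * card {d. pairing d e = 1}) = (of_nat 32 :: complex)" by simp
  then have one: "card {d. pairing d e = 1} = 16" by (simp only: of_nat_eq_iff)
  have "{d. pairing d e = 0} = - {d. pairing d e = 1}" by auto
  then have "card {d. pairing d e = 0} = 16" by (simp add: Compl_eq_Diff_UNIV card_Diff_subset card_slope_funs one)
  then show ?thesis using one by (cases x) auto
qed

lemma card_weight: "card {b :: slope \<Rightarrow> bit. weight b = k} = 5 choose k"
proof -
  have "bij_betw (\<lambda>b. {i. b i = 1}) {b :: slope \<Rightarrow> bit. weight b = k} {A. A \<subseteq> UNIV \<and> card A = k}"
    by (rule bij_betwI[of _ _ _ "\<lambda>A i. if i \<in> A then 1 else 0"]) (auto simp: weight_def fun_eq_iff)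
  then have "card {b :: slope \<Rightarrow> bit. weight b = k} = card {A :: slope set. A \<subseteq> UNIV \<and> card A = k}"
    by (rule bij_betw_same_card)
  then show ?thesis by (simp only: n_subsets[OF finite] card_slope)
qed

text \<open>There are \<open>32 * 32\<close> elements with \<open>a = c = 0\<close>. Among the \<open>32 * 32\<close> elements with \<open>a = 0\<close> and \<open>c = 1\<close>, each
  of the ten \<open>b\<close> of weight 3 and the ten \<open>b\<close> of weight 2 excludes half of the 32 possible \<open>d\<close>.\<close>

lemma card_no_balanced_multiple: "card {h. \<not> (\<exists>h'. balanced (ring_mult h h'))} = 1728"
proof -
  define K :: "((slope \<Rightarrow> bit) \<times> (slope \<Rightarrow> bit)) set" where
    "K = (SIGMA b:{b. weight b = 3}. {d. pairing d (b + 1) = 0}) \<union>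
         (SIGMA b:{b. weight b = 2}. {d. pairing d b = 1})"
  have nonzero: "b + 1 \<noteq> 0" if "weight b = 3" for b :: "slope \<Rightarrow> bit"
    using that weight_complement[of b] card_slope weight_eq_0_iff[of "b + 1"] by auto
  have nonzero': "b \<noteq> 0" if "weight b = 2" for b :: "slope \<Rightarrow> bit"
    using that weight_eq_0_iff[of b] by auto
  have "card K = (\<Sum>b\<in>{b :: slope \<Rightarrow> bit. weight b = 3}. 16) + (\<Sum>b\<in>{b :: slope \<Rightarrow> bit. weight b = 2}. 16)"
    unfolding K_def
    by (subst card_Un_disjoint) (auto simp: card_SigmaI card_pairing_eq nonzero nonzero' intro!: sum.cong)
  also have "\<dots> = 320" by (simp add: card_weight numeral_eq_Suc)
  finally have K: "card K = 320" .
  have good: "{h. \<not> (\<exists>h'. balanced (ring_mult h h'))} =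
      (\<lambda>(b, d). (0, b, 0, d)) ` UNIV \<union> (\<lambda>(b, d). (0, b, 1, d)) ` (- K)"
  proof (rule Set.set_eqI)
    fix h :: coords
    obtain a b c d where h: "h = (a, b, c, d)" by (cases h)
    show "h \<in> {h. \<not> (\<exists>h'. balanced (ring_mult h h'))} \<longleftrightarrow>
      h \<in> (\<lambda>(b, d). (0, b, 0, d)) ` UNIV \<union> (\<lambda>(b, d). (0, b, 1, d)) ` (- K)"
    proof -
      have "(a, b, c, d) \<in> (\<lambda>(b, d). (0, b, 0, d)) ` UNIV \<longleftrightarrow> a = 0 \<and> c = 0"
        by auto
      moreover have "(a, b, c, d) \<in> (\<lambda>(b, d). (0, b, 1, d)) ` (- K) \<longleftrightarrow> a = 0 \<and> c = 1 \<and> (b, d) \<notin> K"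
        by auto
      moreover have "(b, d) \<in> K \<longleftrightarrow>
          weight b = 3 \<and> pairing d (b + 1) = 0 \<or> weight b = 2 \<and> pairing d b = 1"
        by (simp add: K_def)
      ultimately show ?thesis
        unfolding h mem_Collect_eq balanced_multiple_iff Un_iff by (cases a; cases c) simp_all
    qed
  qed
  have card_coords: "card ((\<lambda>(b, d). (x, b, y, d)) ` Z) = card Z"
    for x y :: bit and Z :: "((slope \<Rightarrow> bit) \<times> (slope \<Rightarrow> bit)) set"
    by (intro card_image) (auto intro: inj_onI)
  have pairs: "card (UNIV :: ((slope \<Rightarrow> bit) \<times> (slope \<Rightarrow> bit)) set) = 1024"
    by (simp add: card_slope_funs)
  have "card (- K) = 704"
    by (simp add: Compl_eq_Diff_UNIV card_Diff_subset K pairs del: card_prod)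
  moreover have "card {h. \<not> (\<exists>h'. balanced (ring_mult h h'))} =
      card ((\<lambda>(b, d). (0 :: bit, b, 0 :: bit, d)) ` (UNIV :: ((slope \<Rightarrow> bit) \<times> (slope \<Rightarrow> bit)) set)) +
      card ((\<lambda>(b, d). (0 :: bit, b, 1 :: bit, d)) ` (- K))"
    unfolding good by (rule card_Un_disjoint) auto
  ultimately show ?thesis by (simp only: card_coords pairs)
qed

lemma card_push_fixed: "card {S. push S = S} = 4096"
proof -
  have "card (UNIV :: coords set) = 4096"
    by (simp add: card_slope_funs card_UNIV_bit)
  then show ?thesis
    unfolding push_fixed_eq_range using card_image[OF inj_invariant_fun] by simp
qed

lemma card_nonvanishing:
  "card {S. push S = S \<and> (\<forall>T. push T = T \<longrightarrow> (\<Sum>v\<in>UNIV. bsign (pairing T (shift v S))) \<noteq> 0)} = 1728"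
proof -
  have "{S. push S = S \<and> (\<forall>T. push T = T \<longrightarrow> (\<Sum>v\<in>UNIV. bsign (pairing T (shift v S))) \<noteq> 0)} =
    invariant_fun ` {h. \<not> (\<exists>h'. balanced (ring_mult h h'))}"
    (is "?X = ?Y")
  proof -
    have "?X = {S \<in> {S. push S = S}. \<forall>T\<in>{T. push T = T}. (\<Sum>v\<in>UNIV. bsign (pairing T (shift v S))) \<noteq> 0}"
      by auto
    also have "\<dots> = ?Y"
      unfolding push_fixed_eq_range
      by (auto simp: pairing_shift_invariant_fun sum_bsign_invariant_fun_eq_0_iff)
    finally show ?thesis .
  qed
  moreover have "inj_on invariant_fun A" for A
    using inj_invariant_fun by (rule inj_on_subset) simp
  ultimately show ?thesis using card_no_balanced_multiple by (simp only: card_image)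
qed

lemma card_V: "card (UNIV :: V set) = 128"
  by (simp add: card_UNIV_bit)

theorem theorem1:
  shows "\<exists>(A :: int monoid) (G :: nat monoid) \<phi>.
    coprime_action A G \<phi> \<and>
    faithful_action A (carrier G) \<phi> \<and>
    A \<cong> integer_mod_group 21 \<and>
    Coset.order G = 2 ^ 135 \<and>
    card (Irr_inv_nonvanishing A G \<phi>) = 1728 \<and>
    Coset.order (abelianization (fixed_group A G \<phi>)) = 4096 \<and>
    card (Irr_inv_nonvanishing A G \<phi>) \<noteq> Coset.order (abelianization (fixed_group A G \<phi>))"
proof (intro exI conjI)
  let ?A = "integer_mod_group 21" and ?G = "wreath TYPE(V)"
  have order: "(2 :: nat) ^ 128 * 128 = 2 ^ 135" by simp
  have "coprime (21 :: nat) (2 ^ k)" for k by simp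
  then show "coprime_action ?A ?G action"
    by (intro coprime_action) (simp only: card_V order)
  show "faithful_action ?A (carrier ?G) action" by (rule faithful_action)
  show "?A \<cong> integer_mod_group 21" by (rule iso_refl)
  show "Coset.order ?G = 2 ^ 135" unfolding order_wreath card_V by (rule order)
  show N: "card (Irr_inv_nonvanishing ?A ?G action) = 1728"
    unfolding card_Irr_inv_nonvanishing by (rule card_nonvanishing)
  show C: "Coset.order (abelianization (fixed_group ?A ?G action)) = 4096"
    unfolding order_abelianization_fixed_group by (rule card_push_fixed)
  show "card (Irr_inv_nonvanishing ?A ?G action) \<noteq> Coset.order (abelianization (fixed_group ?A ?G action))"
    unfolding N C by simp
qed

end
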